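(* Let $f(x)=(1-x)^{\alpha}(1+x)^{\beta}\log(1-x)\,g(x)$ on $[-1,1]$, where $\alpha$ is a positive integer, $\beta\ge 0$ is real, and $g\in C^{\infty}[-1,1]$. Define $$s=\begin{cases}2\alpha, & \text{if }\beta\text{ is an integer},\\ 2\min\{\alpha,\beta\}, & \text{otherwise}.\end{cases}$$ Then the error of the $(n+1)$-point Clenshaw-Curtis quadrature for the integral $\int_{-1}^1f(x)\,dx$ satisfies $$E_n^C[f]=\mathcal{O}(n^{-s-2}),\qquad n\to\infty.$$
   Context: The value of $f$ at $x=1$ is its limit $f(1)=0$; a factor with exponent $0$ is identically $1$. The $(n+1)$-point Clenshaw-Curtis rule is $I_n^C[f]=\sum_{j=0}^n w_jf(x_j)$ with nodes $x_j=\cos(j\pi/n)$, $j=0,\dots,n$, and weights $$w_j=\frac{4\delta_j}{n}\sum_{k=0}^{\lfloor n/2\rfloor}\frac{\delta_{2k}}{1-4k^2}\cos\Big(\frac{2jk\pi}{n}\Big),$$ where $\delta_j=1/2$ if $j=0$ or $j=n$, and $\delta_j=1$ otherwise; equivalently, it is the interpolatory quadrature rule at these nodes (exact for polynomials of degree at most $n$). The error is $E_n^C[f]=\int_{-1}^1f(x)\,dx-I_n^C[f]$. *)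

theory Defs
  imports "HOL-Analysis.Analysis" "HOL-Library.Landau_Symbols"
begin

text \<open>
  \<open>g\<close> is infinitely differentiable on the set \<open>S\<close>: \<open>D k\<close> is the \<open>k\<close>-th derivative of \<open>g\<close> on \<open>S\<close>.
  Derivatives are taken within \<open>S\<close>, so on a closed interval they are one-sided at the end points,
  and values of \<open>g\<close> outside \<open>S\<close> are irrelevant.
\<close>

definition C_inf_on :: "real set \<Rightarrow> (real \<Rightarrow> real) \<Rightarrow> bool" where
  "C_inf_on S g \<longleftrightarrow>
     (\<exists>D :: nat \<Rightarrow> real \<Rightarrow> real.
        (\<forall>x\<in>S. D 0 x = g x) \<and>
        (\<forall>k. \<forall>x\<in>S. (D k has_real_derivative D (Suc k) x) (at x within S)))"

definition cc_node :: "nat \<Rightarrow> nat \<Rightarrow> real" where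
  "cc_node n j = cos (real j * pi / real n)"

definition cc_delta :: "nat \<Rightarrow> nat \<Rightarrow> real" where
  "cc_delta n j = (if j = 0 \<or> j = n then 1 / 2 else 1)"

definition cc_weight :: "nat \<Rightarrow> nat \<Rightarrow> real" where
  "cc_weight n j =
     4 * cc_delta n j / real n *
     (\<Sum>k = 0..n div 2. cc_delta n (2 * k) / (1 - 4 * (real k)\<^sup>2)
                          * cos (2 * real j * real k * pi / real n))"

text \<open>The \<open>(n+1)\<close>-point rule; it is meaningful for \<open>n \<ge> 1\<close>.\<close>

definition cc_rule :: "nat \<Rightarrow> (real \<Rightarrow> real) \<Rightarrow> real" where
  "cc_rule n f = (\<Sum>j = 0..n. cc_weight n j * f (cc_node n j))"

definition cc_error :: "nat \<Rightarrow> (real \<Rightarrow> real) \<Rightarrow> real" where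
  "cc_error n f = integral {-1..1} f - cc_rule n f"

text \<open>
  The value at \<open>x = 1\<close> is the limit \<open>0\<close>. The case \<open>\<beta> = 0\<close> is separated because \<open>0 powr 0 = 0\<close>,
  whereas a factor with exponent \<open>0\<close> is identically \<open>1\<close>, also at \<open>x = -1\<close>.
\<close>

definition log_jacobi_fun :: "nat \<Rightarrow> real \<Rightarrow> (real \<Rightarrow> real) \<Rightarrow> real \<Rightarrow> real" where
  "log_jacobi_fun \<alpha> \<beta> g x =
     (if x = 1 then 0
      else (1 - x) ^ \<alpha> * (if \<beta> = 0 then 1 else (1 + x) powr \<beta>) * ln (1 - x) * g x)"

definition cc_rate :: "nat \<Rightarrow> real \<Rightarrow> real" where
  "cc_rate \<alpha> \<beta> = (if \<beta> \<in> \<int> then 2 * real \<alpha> else 2 * min (real \<alpha>) \<beta>)"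

end

theory Submission
  imports Defs
begin

text \<open>
  Write \<open>f(cos t) = \<Sum>' a\<^sub>m cos(m t)\<close>. Clenshaw-Curtis quadrature integrates the Chebyshev
  polynomials \<open>T\<^sub>m\<close> with \<open>m \<le> n\<close> exactly, and at the nodes \<open>T\<^bsub>2pn \<plusminus> r\<^esub>\<close> coincides with \<open>T\<^sub>r\<close>
  for \<open>r \<le> n\<close>. Hence the error is \<open>\<Sum> a\<^sub>m (c\<^sub>m - c\<^sub>r)\<close> over \<open>m = 2pn \<plusminus> r\<close>, \<open>p \<ge> 1\<close>, where
  \<open>c\<^sub>m = \<integral> T\<^sub>m = 2 / (1 - m\<^sup>2)\<close> for even \<open>m\<close> and \<open>c\<^sub>m = 0\<close> for odd \<open>m\<close>.

  The coefficients are of size \<open>a\<^sub>m = O(m\<^bsup>-s-1\<^esup>)\<close>. Inserting this size alone gives only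
  \<open>O(n\<^bsup>-s-1\<^esup>)\<close>, because \<open>c\<^sub>0, c\<^sub>2, \<dots>\<close> do not become small with \<open>n\<close>. The missing power comes
  from cancellation: \<open>c\<^sub>0 + 2 (c\<^sub>2 + c\<^sub>4 + \<dots>) = 0\<close>, with partial sums \<open>O(1/n)\<close>, so in the block
  around \<open>M = 2pn\<close> one may subtract \<open>a\<^sub>M\<close> from each coefficient, and what is left are symmetric
  second differences \<open>a\<^bsub>M+r\<^esub> + a\<^bsub>M-r\<^esub> - 2 a\<^sub>M\<close>, for even \<open>r\<close> (\<open>alias_block_bound\<close>). These are small
  for a simple reason. Taking the second difference with step \<open>2\<close> multiplies \<open>f(cos t)\<close> by
  \<open>2 cos 2t - 2 = -4 (1 - x\<^sup>2)\<close> with \<open>x = cos t\<close> (\<open>cheb_int_second_difference\<close>), and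
  \<open>(1 - x\<^sup>2) f\<close> is a function of the same kind as \<open>f\<close> with both exponents raised by one (a factor \<open>1 + x\<close> is smooth when \<open>\<beta>\<close> is an integer), so its
  coefficients are \<open>O(m\<^bsup>-s-3\<^esup>)\<close>. The second differences with step \<open>r\<close> are then \<open>O(r\<^sup>2 M\<^bsup>-s-3\<^esup>)\<close>, the
  factor \<open>r\<^sup>2\<close> is absorbed by \<open>c\<^sub>r\<close>, and the block contributes \<open>O(M\<^bsup>-s-1\<^esup> / n)\<close>. Summing over \<open>p\<close>
  is harmless since \<open>s > 0\<close>.

  It remains to prove the decay of \<open>a\<^sub>m\<close>. Integrating by parts twice in \<open>t\<close> replaces \<open>f\<close> by
  \<open>(1 - x\<^sup>2) f'' - x f'\<close> and gains \<open>m\<^bsup>-2\<^esup>\<close> (\<open>cheb_int_step\<close>). On functions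
  \<open>(1 - x)\<^sup>a (1 + x)\<^sup>b (ln(1 - x) g + h)\<close> with smooth \<open>g\<close> and \<open>h\<close> this operator lowers \<open>a\<close> and \<open>b\<close> by
  one, and it preserves \<open>b = 0\<close>, which stands for smoothness at \<open>-1\<close>; there an integer \<open>\<beta>\<close> has
  been absorbed into \<open>g\<close>. A logarithm without algebraic factor gives \<open>O(1/m)\<close>, and
  \<open>(1 + x)\<^sup>b\<close> with \<open>0 < b < 1\<close> gives \<open>O(m\<^bsup>-2b-1\<^esup>)\<close>. Both follow from the same estimate
  (\<open>endpoint_oscillatory_bound\<close>), in which the integral is cut at distance \<open>1/m\<close> from the singular
  end. For noninteger \<open>\<beta>\<close> a polynomial partition of unity first makes one end at a time as
  flat as desired, so that the two singularities never interact (\<open>cheb_int_decay_both_ends\<close>).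
\<close>

section \<open>Smooth functions on a set\<close>

text \<open>
  Closure properties of smoothness are awkward to prove with an explicit sequence of derivatives
  (products would need the Leibniz rule). It suffices to exhibit a class of functions that is closed
  under taking some derivative.
\<close>

lemma C_inf_on_coinduct:
  assumes "P g"
    and step: "\<And>f. P f \<Longrightarrow> \<exists>f'. P f' \<and> (\<forall>x\<in>S. (f has_real_derivative f' x) (at x within S))"
  shows "C_inf_on S g"
proof -
  define nxt where "nxt f = (SOME f'. P f' \<and> (\<forall>x\<in>S. (f has_real_derivative f' x) (at x within S)))" for f
  define D where "D = rec_nat g (\<lambda>_. nxt)"
  have nxt: "P (nxt f) \<and> (\<forall>x\<in>S. (f has_real_derivative nxt f x) (at x within S))" if "P f" for f
    using someI_ex[OF step[OF that]] unfolding nxt_def .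
  have P: "P (D k)" for k
    by (induction k) (auto simp: D_def assms nxt)
  show ?thesis
    unfolding C_inf_on_def
  proof (intro exI[of _ D] conjI allI ballI)
    fix x assume "x \<in> S" show "D 0 x = g x" by (simp add: D_def)
  next
    fix k x assume "x \<in> S"
    thus "(D k has_real_derivative D (Suc k) x) (at x within S)"
      using nxt[OF P[of k]] by (simp add: D_def)
  qed
qed

lemma C_inf_on_derivative:
  assumes "C_inf_on S g"
  obtains g' where "C_inf_on S g'" "\<And>x. x \<in> S \<Longrightarrow> (g has_real_derivative g' x) (at x within S)"
proof -
  obtain D where D0: "\<And>x. x \<in> S \<Longrightarrow> D 0 x = g x"
    and D: "\<And>k x. x \<in> S \<Longrightarrow> (D k has_real_derivative D (Suc k) x) (at x within S)"
    using assms unfolding C_inf_on_def by blast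
  have "C_inf_on S (D 1)"
    unfolding C_inf_on_def by (rule exI[of _ "\<lambda>k. D (Suc k)"]) (use D in auto)
  moreover have "(g has_real_derivative D 1 x) (at x within S)" if "x \<in> S" for x
    using has_derivative_transform[OF that, of g "D 0"] D[OF that, of 0] D0
    by (simp add: has_field_derivative_def)
  ultimately show ?thesis using that by blast
qed

lemma C_inf_on_const: "C_inf_on S (\<lambda>x. c)"
proof (rule C_inf_on_coinduct[where P = "\<lambda>f. \<exists>c. f = (\<lambda>x. c)"])
  fix f :: "real \<Rightarrow> real" assume "\<exists>c. f = (\<lambda>x. c)"
  thus "\<exists>f'. (\<exists>c. f' = (\<lambda>x. c)) \<and> (\<forall>x\<in>S. (f has_real_derivative f' x) (at x within S))"
    by (intro exI[of _ "\<lambda>x. 0"]) auto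
qed auto

lemma C_inf_on_ident: "C_inf_on S (\<lambda>x. x)"
proof (rule C_inf_on_coinduct[where P = "\<lambda>f. f = (\<lambda>x. x) \<or> (\<exists>c. f = (\<lambda>x. c))"])
  fix f :: "real \<Rightarrow> real" assume "f = (\<lambda>x. x) \<or> (\<exists>c. f = (\<lambda>x. c))"
  thus "\<exists>f'. (f' = (\<lambda>x. x) \<or> (\<exists>c. f' = (\<lambda>x. c))) \<and> (\<forall>x\<in>S. (f has_real_derivative f' x) (at x within S))"
  proof
    assume "f = (\<lambda>x. x)" thus ?thesis by (intro exI[of _ "\<lambda>x. 1"]) auto
  next
    assume "\<exists>c. f = (\<lambda>x. c)" thus ?thesis by (intro exI[of _ "\<lambda>x. 0"]) auto
  qed
qed auto

text \<open>
  Derivatives of products of smooth functions are sums of such products, so the algebra generated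
  by the smooth functions is closed under differentiation and hence consists of smooth functions.
\<close>

inductive smooth_algebra :: "real set \<Rightarrow> (real \<Rightarrow> real) \<Rightarrow> bool" for S where
  base: "C_inf_on S f \<Longrightarrow> smooth_algebra S f"
| add: "smooth_algebra S f \<Longrightarrow> smooth_algebra S g \<Longrightarrow> smooth_algebra S (\<lambda>x. f x + g x)"
| mult: "smooth_algebra S f \<Longrightarrow> smooth_algebra S g \<Longrightarrow> smooth_algebra S (\<lambda>x. f x * g x)"

lemma C_inf_on_smooth_algebra:
  assumes "smooth_algebra S g" shows "C_inf_on S g"
proof (rule C_inf_on_coinduct[where P = "smooth_algebra S", OF assms])
  fix f assume "smooth_algebra S f"
  thus "\<exists>f'. smooth_algebra S f' \<and> (\<forall>x\<in>S. (f has_real_derivative f' x) (at x within S))"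
  proof induction
    case (base f)
    thus ?case by (meson C_inf_on_derivative smooth_algebra.base)
  next
    case (add f g)
    then obtain f' g' where "smooth_algebra S f'" "smooth_algebra S g'"
      "\<forall>x\<in>S. (f has_real_derivative f' x) (at x within S)"
      "\<forall>x\<in>S. (g has_real_derivative g' x) (at x within S)" by blast
    thus ?case
      by (intro exI[of _ "\<lambda>x. f' x + g' x"]) (auto intro!: smooth_algebra.add DERIV_add)
  next
    case (mult f g)
    then obtain f' g' where "smooth_algebra S f'" "smooth_algebra S g'"
      "\<forall>x\<in>S. (f has_real_derivative f' x) (at x within S)"
      "\<forall>x\<in>S. (g has_real_derivative g' x) (at x within S)" by blast
    thus ?case using mult.hyps
      by (intro exI[of _ "\<lambda>x. f' x * g x + g' x * f x"])
         (auto intro!: smooth_algebra.intros(2,3) DERIV_mult)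
  qed
qed

lemma C_inf_on_add: "C_inf_on S f \<Longrightarrow> C_inf_on S g \<Longrightarrow> C_inf_on S (\<lambda>x. f x + g x)"
  by (rule C_inf_on_smooth_algebra, rule smooth_algebra.add) (rule smooth_algebra.base, assumption)+

lemma C_inf_on_mult: "C_inf_on S f \<Longrightarrow> C_inf_on S g \<Longrightarrow> C_inf_on S (\<lambda>x. f x * g x)"
  by (rule C_inf_on_smooth_algebra, rule smooth_algebra.mult) (rule smooth_algebra.base, assumption)+

lemma C_inf_on_minus: 
  assumes "C_inf_on S f" shows "C_inf_on S (\<lambda>x. - f x)"
  using C_inf_on_mult[OF C_inf_on_const[of S "-1"] assms] by simp

lemma C_inf_on_diff: 
  assumes "C_inf_on S f" "C_inf_on S g" shows "C_inf_on S (\<lambda>x. f x - g x)"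
  using C_inf_on_add[OF assms(1) C_inf_on_minus[OF assms(2)]] by simp

lemma C_inf_on_power: 
  assumes "C_inf_on S f" shows "C_inf_on S (\<lambda>x. f x ^ k)"
proof (induction k)
  case 0 show ?case using C_inf_on_const[of S 1] by simp
next
  case (Suc k) show ?case using C_inf_on_mult[OF assms Suc] by simp
qed

lemma C_inf_on_sum:
  assumes "\<And>i. i \<in> I \<Longrightarrow> C_inf_on S (f i)" shows "C_inf_on S (\<lambda>x. \<Sum>i\<in>I. f i x)"
  using assms
proof (induction I rule: infinite_finite_induct)
  case (insert i I)
  have "C_inf_on S (\<lambda>x. f i x + (\<Sum>i\<in>I. f i x))" using insert by (intro C_inf_on_add) auto
  thus ?case using insert by simp
qed (use C_inf_on_const[of S 0] in simp_all)

lemmas C_inf_on_intros =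
  C_inf_on_add C_inf_on_mult C_inf_on_diff C_inf_on_minus C_inf_on_power C_inf_on_sum
  C_inf_on_const C_inf_on_ident

lemma C_inf_on_continuous: "C_inf_on S f \<Longrightarrow> continuous_on S f"
  by (meson C_inf_on_derivative DERIV_continuous_on)

lemma C_inf_on_bounded:
  assumes "C_inf_on {-1..1} f"
  obtains K where "K \<ge> 0" "\<And>x. -1 \<le> x \<Longrightarrow> x \<le> 1 \<Longrightarrow> \<bar>f x\<bar> \<le> K"
proof -
  have "bounded (f ` {-1..1})"
    by (intro compact_imp_bounded compact_continuous_image C_inf_on_continuous assms) simp
  then obtain K where "K > 0" "\<forall>y \<in> f ` {-1..1}. \<bar>y\<bar> \<le> K"
    unfolding bounded_pos by auto
  thus ?thesis using that[of K] by auto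
qed

section \<open>Algebraic and logarithmic endpoint singularities\<close>

text \<open>
  The exponent of \<open>1 - x\<close> is kept separately for the logarithmic part (a natural number) and for the
  rest. Differentiating \<open>ln (1 - x)\<close> produces the pole \<open>(1 - x)\<^bsup>-1\<^esup>\<close>, but the coefficient of the
  logarithm itself does not acquire a pole. Once its exponent is \<open>0\<close> it stays \<open>0\<close>, while \<open>c\<close> continues to
  decrease. Tracking this is what avoids a spurious logarithmic factor in the final rates. The
  description is required only on the open interval, where the powers are unproblematic.
\<close>

definition jacobi_log :: "nat \<Rightarrow> real \<Rightarrow> real \<Rightarrow> (real \<Rightarrow> real) \<Rightarrow> bool" where
  "jacobi_log a c b f \<longleftrightarrow> (\<exists>g h. C_inf_on {-1..1} g \<and> C_inf_on {-1..1} h \<and>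
     (\<forall>x\<in>{-1<..<1}. f x = (1 + x) powr b * ((1 - x) ^ a * ln (1 - x) * g x + (1 - x) powr c * h x)))"

lemma jacobi_logI:
  assumes "C_inf_on {-1..1} g" "C_inf_on {-1..1} h"
    "\<And>x. -1 < x \<Longrightarrow> x < 1 \<Longrightarrow> f x = (1 + x) powr b * ((1 - x) ^ a * ln (1 - x) * g x + (1 - x) powr c * h x)"
  shows "jacobi_log a c b f"
  using assms unfolding jacobi_log_def by auto

lemma jacobi_logE:
  assumes "jacobi_log a c b f"
  obtains g h where "C_inf_on {-1..1} g" "C_inf_on {-1..1} h"
    "\<And>x. -1 < x \<Longrightarrow> x < 1 \<Longrightarrow> f x = (1 + x) powr b * ((1 - x) ^ a * ln (1 - x) * g x + (1 - x) powr c * h x)"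
  using assms unfolding jacobi_log_def by auto

lemma jacobi_log_add:
  assumes "jacobi_log a c b f1" "jacobi_log a c b f2"
  shows "jacobi_log a c b (\<lambda>x. f1 x + f2 x)"
proof -
  obtain g1 h1 where 1: "C_inf_on {-1..1} g1" "C_inf_on {-1..1} h1"
    "\<And>x. -1 < x \<Longrightarrow> x < 1 \<Longrightarrow> f1 x = (1 + x) powr b * ((1 - x) ^ a * ln (1 - x) * g1 x + (1 - x) powr c * h1 x)"
    using assms(1) by (rule jacobi_logE) blast
  obtain g2 h2 where 2: "C_inf_on {-1..1} g2" "C_inf_on {-1..1} h2"
    "\<And>x. -1 < x \<Longrightarrow> x < 1 \<Longrightarrow> f2 x = (1 + x) powr b * ((1 - x) ^ a * ln (1 - x) * g2 x + (1 - x) powr c * h2 x)"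
    using assms(2) by (rule jacobi_logE) blast
  show ?thesis
  proof (rule jacobi_logI)
    show "C_inf_on {-1..1} (\<lambda>x. g1 x + g2 x)" "C_inf_on {-1..1} (\<lambda>x. h1 x + h2 x)"
      by (intro C_inf_on_intros 1(1,2) 2(1,2))+
  qed (use 1(3) 2(3) in \<open>simp add: algebra_simps\<close>)
qed

lemma jacobi_log_times_smooth:
  assumes "jacobi_log a c b f" "C_inf_on {-1..1} p"
  shows "jacobi_log (a + i) (c + real i) (b + real k) (\<lambda>x. (1 - x) ^ i * (1 + x) ^ k * p x * f x)"
proof -
  obtain g h where 1: "C_inf_on {-1..1} g" "C_inf_on {-1..1} h"
    "\<And>x. -1 < x \<Longrightarrow> x < 1 \<Longrightarrow> f x = (1 + x) powr b * ((1 - x) ^ a * ln (1 - x) * g x + (1 - x) powr c * h x)"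
    using assms(1) by (rule jacobi_logE) blast
  show ?thesis
  proof (rule jacobi_logI)
    show "C_inf_on {-1..1} (\<lambda>x. p x * g x)" "C_inf_on {-1..1} (\<lambda>x. p x * h x)"
      by (intro C_inf_on_intros 1(1,2) assms(2))+
  qed (use 1(3) in \<open>simp add: powr_add powr_realpow power_add algebra_simps\<close>)
qed

lemma jacobi_log_weaken:
  assumes "jacobi_log (a + i) (c + real j) (b + real k) f"
  shows "jacobi_log a c b f"
proof -
  obtain g h where 1: "C_inf_on {-1..1} g" "C_inf_on {-1..1} h"
    "\<And>x. -1 < x \<Longrightarrow> x < 1 \<Longrightarrow> f x = (1 + x) powr (b + real k) * ((1 - x) ^ (a + i) * ln (1 - x) * g x + (1 - x) powr (c + real j) * h x)"
    using assms(1) by (rule jacobi_logE) blast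
  show ?thesis
  proof (rule jacobi_logI)
    show "C_inf_on {-1..1} (\<lambda>x. (1 + x) ^ k * (1 - x) ^ i * g x)" "C_inf_on {-1..1} (\<lambda>x. (1 + x) ^ k * (1 - x) ^ j * h x)"
      by (intro C_inf_on_intros 1(1,2))+
  qed (use 1(3) in \<open>simp add: powr_add powr_realpow power_add algebra_simps\<close>)
qed

text \<open>
  The exponent \<open>0\<close> at \<open>-1\<close> means that there is no singularity there, hence the alternative
  \<open>b = b' = 0\<close>. The subtraction \<open>a - 1\<close> is truncated, as explained at the definition. The
  assumption on \<open>k\<close> allows the term \<open>(1 - x)\<^bsup>a-1\<^esup> g\<close>, which comes from the derivative of the logarithm,
  to be moved into the part without logarithm.
\<close>

lemma jacobi_log_deriv:
  assumes f: "jacobi_log a c b f" and k: "real a = c + real k"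
    and d: "b' = b - 1 \<or> b = 0 \<and> b' = 0"
  obtains f' where "jacobi_log (a - 1) (c - 1) b' f'"
    "\<And>x. -1 < x \<Longrightarrow> x < 1 \<Longrightarrow> (f has_real_derivative f' x) (at x)"
proof -
  obtain g h where gh: "C_inf_on {-1..1} g" "C_inf_on {-1..1} h"
    and eq: "\<And>x. -1 < x \<Longrightarrow> x < 1 \<Longrightarrow> f x = (1 + x) powr b * ((1 - x) ^ a * ln (1 - x) * g x + (1 - x) powr c * h x)"
    using f by (rule jacobi_logE) blast
  obtain g' where g': "C_inf_on {-1..1} g'" and dg: "\<And>x. x \<in> {-1..1} \<Longrightarrow> (g has_real_derivative g' x) (at x within {-1..1})"
    using gh(1) by (rule C_inf_on_derivative) blast
  obtain h' where h': "C_inf_on {-1..1} h'" and dh: "\<And>x. x \<in> {-1..1} \<Longrightarrow> (h has_real_derivative h' x) (at x within {-1..1})"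
    using gh(2) by (rule C_inf_on_derivative) blast
  \<comment> \<open>\<open>d\<close> and \<open>e\<close> count by how much the exponents at \<open>-1\<close> and \<open>1\<close> really drop, so that the four cases have one formula.\<close>
  obtain d :: nat where d: "b = b' + real d" "b = b * real d" "d \<le> 1"
  proof -
    from d show ?thesis
    proof
      assume "b' = b - 1" thus ?thesis using that[of 1] by simp
    next
      assume "b = 0 \<and> b' = 0" thus ?thesis using that[of 0] by simp
    qed
  qed
  define e :: nat where "e = (if a = 0 then 0 else 1)"
  define G where "G x = b * (1 - x) ^ e * g x + (1 + x) ^ d * (- real a * g x + (1 - x) ^ e * g' x)" for x
  define H where "H x = b * (1 - x) * h x + (1 + x) ^ d * (- c * h x + (1 - x) * h' x - (1 - x) ^ k * g x)" for x
  define f' where "f' x = (1 + x) powr b' * ((1 - x) ^ (a - 1) * ln (1 - x) * G x + (1 - x) powr (c - 1) * H x)" for x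
  show ?thesis
  proof (rule that[of f'])
    show "jacobi_log (a - 1) (c - 1) b' f'"
    proof (rule jacobi_logI[of G H])
      show "C_inf_on {-1..1} G" "C_inf_on {-1..1} H"
        unfolding G_def[abs_def] H_def[abs_def]
        by (intro C_inf_on_add C_inf_on_mult C_inf_on_diff C_inf_on_power gh g' h' C_inf_on_const C_inf_on_ident C_inf_on_minus)+
    qed (simp add: f'_def)
  next
    fix x :: real assume x: "-1 < x" "x < 1"
    have int: "at x within {-1..1} = at x"
      by (rule at_within_interior) (use x in auto)
    have dg': "(g has_real_derivative g' x) (at x)" and dh': "(h has_real_derivative h' x) (at x)"
      using dg[of x] dh[of x] x int by auto
    define W where "W x = (1 - x) ^ a * ln (1 - x) * g x + (1 - x) powr c * h x" for x
    define W' where "W' = (1 - x) ^ (a - 1) * ln (1 - x) * (- real a * g x + (1 - x) ^ e * g' x)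
      + (1 - x) powr (c - 1) * (- c * h x + (1 - x) * h' x - (1 - x) ^ k * g x)"
    have pa: "(1 - x) ^ a = (1 - x) ^ (a - 1) * (1 - x) ^ e"
      by (cases a) (auto simp: e_def)
    have pc: "(1 - x) powr c = (1 - x) powr (c - 1) * (1 - x)"
      using x by (simp add: powr_diff)
    have pk: "(1 - x) ^ a / (1 - x) = (1 - x) powr (c - 1) * (1 - x) ^ k"
    proof -
      have "(1 - x) ^ a = (1 - x) powr (c + real k)"
        using x k by (simp add: powr_realpow flip: k)
      also have "\<dots> = (1 - x) powr c * (1 - x) ^ k" using x by (simp add: powr_add powr_realpow)
      finally show ?thesis using x by (simp add: powr_diff)
    qed
    have dW: "(W has_real_derivative W') (at x)"
    proof -
      have "(W has_real_derivative
         (((- (real a * (1 - x) ^ (a - 1))) * ln (1 - x) + (1 - x) ^ a * (- (1 / (1 - x)))) * g x + (1 - x) ^ a * ln (1 - x) * g' x)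
         + ((- c * (1 - x) powr (c - 1)) * h x + (1 - x) powr c * h' x)) (at x)"
        unfolding W_def[abs_def]
        by (rule derivative_eq_intros dg' dh' refl | use x in \<open>simp add: field_simps\<close>)+
      also have "(((- (real a * (1 - x) ^ (a - 1))) * ln (1 - x) + (1 - x) ^ a * (- (1 / (1 - x)))) * g x + (1 - x) ^ a * ln (1 - x) * g' x)
         + ((- c * (1 - x) powr (c - 1)) * h x + (1 - x) powr c * h' x)
         = (- (real a * (1 - x) ^ (a - 1))) * ln (1 - x) * g x - ((1 - x) ^ a / (1 - x)) * g x + (1 - x) ^ a * ln (1 - x) * g' x
         + ((- c * (1 - x) powr (c - 1)) * h x + (1 - x) powr c * h' x)"
        by (simp add: algebra_simps)
      also have "\<dots> = W'"
        unfolding pk unfolding pc pa W'_def by (simp add: algebra_simps)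
      finally show ?thesis .
    qed
    have pb: "(1 + x) powr b = (1 + x) powr b' * (1 + x) ^ d"
      using x by (simp add: d(1) powr_add powr_realpow)
    have pb': "b * (1 + x) powr (b - 1) = b * (1 + x) powr b'"
      proof (cases "d = 0")
      case False
      hence "d = 1" using d(3) by simp
      thus ?thesis using d(1) by simp
    qed (use d(2) in simp)
    have "((\<lambda>x. (1 + x) powr b * W x) has_real_derivative
        (b * (1 + x) powr (b - 1)) * W x + (1 + x) powr b * W') (at x)"
      by (rule derivative_eq_intros dW refl | use x in simp)+
    also have "(b * (1 + x) powr (b - 1)) * W x + (1 + x) powr b * W' = f' x"
      unfolding pb pb' W_def pa pc f'_def G_def H_def W'_def by (simp add: algebra_simps)
    finally show "(f has_real_derivative f' x) (at x)"
      by (rule has_field_derivative_transform_within_open[of _ _ _ "{-1<..<1}"])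
         (use x in \<open>auto simp: eq W_def\<close>)
  qed
qed

text \<open>
  The operator \<open>(1 - x\<^sup>2) f'' - x f'\<close> is the second derivative with respect to \<open>t\<close> when \<open>x = cos t\<close>. Two
  derivatives lower the exponents by at most two, and the factor \<open>1 - x\<^sup>2\<close> gives one of them back.
\<close>

lemma jacobi_log_cheb_op:
  assumes f: "jacobi_log a c b f" and k: "real a = c + real k"
    and d: "b' = b - 1 \<or> b = 0 \<and> b' = 0"
  obtains f' f'' where "jacobi_log (a - 1) (c - 1) b' f'"
    "\<And>x. -1 < x \<Longrightarrow> x < 1 \<Longrightarrow> (f has_real_derivative f' x) (at x)"
    "\<And>x. -1 < x \<Longrightarrow> x < 1 \<Longrightarrow> (f' has_real_derivative f'' x) (at x)"
    "jacobi_log (a - 1) (c - 1) b' (\<lambda>x. (1 - x\<^sup>2) * f'' x - x * f' x)"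
proof -
  obtain f' where f': "jacobi_log (a - 1) (c - 1) b' f'"
    "\<And>x. -1 < x \<Longrightarrow> x < 1 \<Longrightarrow> (f has_real_derivative f' x) (at x)"
    using jacobi_log_deriv[OF assms] by blast
  define k' where "k' = (if a = 0 then k + 1 else k)"
  have k': "real (a - 1) = (c - 1) + real k'" using k by (auto simp: k'_def)
  define b'' where "b'' = (if b = 0 \<and> b' = 0 then 0 else b' - 1)"
  have d': "b'' = b' - 1 \<or> b' = 0 \<and> b'' = 0" by (auto simp: b''_def)
  obtain f'' where f'': "jacobi_log (a - 1 - 1) (c - 1 - 1) b'' f''"
    "\<And>x. -1 < x \<Longrightarrow> x < 1 \<Longrightarrow> (f' has_real_derivative f'' x) (at x)"
    using jacobi_log_deriv[OF f'(1) k' d'] by blast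
  have 1: "jacobi_log (a - 1 - 1 + 1) (c - 1) (b'' + 1) (\<lambda>x. (1 - x\<^sup>2) * f'' x)"
    using jacobi_log_times_smooth[OF f''(1) C_inf_on_const[of _ 1], of 1 1]
    by (simp add: algebra_simps power2_eq_square)
  have 2: "jacobi_log (a - 1) (c - 1) b' (\<lambda>x. (1 - x\<^sup>2) * f'' x)"
    by (rule jacobi_log_weaken[where i = "if a - 1 = 0 then 1 else 0" and j = 0 and k = "if b''=b'-1 then 0 else 1"])
       (use 1 d' in \<open>cases "a = 0"; cases "a = 1"; auto simp: Suc_diff_Suc numeral_2_eq_2 split: if_splits\<close>)
  have 3: "jacobi_log (a - 1) (c - 1) b' (\<lambda>x. (-x) * f' x)"
    using jacobi_log_times_smooth[OF f'(1) C_inf_on_minus[OF C_inf_on_ident], of 0 0] by simp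
  have "jacobi_log (a - 1) (c - 1) b' (\<lambda>x. (1 - x\<^sup>2) * f'' x - x * f' x)"
    using jacobi_log_add[OF 2 3] by simp
  with f' f'' show ?thesis using that by blast
qed

lemma abs_ln_le_powr:
  fixes \<delta> v :: real
  assumes "\<delta> > 0" "0 < v" "v < 2"
  shows "\<bar>ln v\<bar> \<le> (1 / \<delta> + 2 powr \<delta>) * v powr - \<delta>"
proof (cases "v \<le> 1")
  case True
  have "\<bar>ln v\<bar> = ln (1 / v)" using True assms by (simp add: ln_div)
  also have "\<dots> \<le> (1 / v) powr \<delta> / \<delta>" by (rule ln_powr_bound) (use True assms in auto)
  also have "(1 / v) powr \<delta> = v powr - \<delta>" using assms by (simp add: powr_divide powr_minus_divide)
  also have "v powr - \<delta> / \<delta> \<le> (1 / \<delta> + 2 powr \<delta>) * v powr - \<delta>" using assms by (simp add: algebra_simps)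
  finally show ?thesis .
next
  case False
  have "\<bar>ln v\<bar> \<le> v - 1" using ln_le_minus_one[of v] False by auto
  also have "\<dots> \<le> 1" using assms by simp
  also have "1 \<le> 2 powr \<delta> * v powr - \<delta>"
  proof -
    have "v powr \<delta> \<le> 2 powr \<delta>" using assms by (intro powr_mono2) auto
    thus ?thesis using assms by (simp add: powr_minus_divide field_simps)
  qed
  also have "\<dots> \<le> (1 / \<delta> + 2 powr \<delta>) * v powr - \<delta>" using assms by (simp add: algebra_simps)
  finally show ?thesis .
qed

lemma powr_le_powr_scaled:
  fixes v p q :: real
  assumes "0 < v" "v < 2" "p \<le> q"
  shows "v powr q \<le> 2 powr (q - p) * v powr p"
proof -
  have "v powr q = v powr (q - p) * v powr p" by (simp flip: powr_add)
  also have "\<dots> \<le> 2 powr (q - p) * v powr p"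
    using assms by (intro mult_right_mono powr_mono2) auto
  finally show ?thesis .
qed

text \<open>
  The strict inequality \<open>c' < a\<close> pays for the logarithm. If \<open>c < 0\<close> and \<open>a = 0\<close>, then \<open>c' = c\<close> is
  admissible and nothing is lost.
\<close>

lemma jacobi_log_bound:
  assumes f: "jacobi_log a c b f" and "c' \<le> c" "c' < real a" "b' \<le> b"
  obtains K where "K \<ge> 0"
    "\<And>x. -1 < x \<Longrightarrow> x < 1 \<Longrightarrow> \<bar>f x\<bar> \<le> K * ((1 - x) powr c' * (1 + x) powr b')"
proof -
  obtain g h where gh: "C_inf_on {-1..1} g" "C_inf_on {-1..1} h"
    and eq: "\<And>x. -1 < x \<Longrightarrow> x < 1 \<Longrightarrow> f x = (1 + x) powr b * ((1 - x) ^ a * ln (1 - x) * g x + (1 - x) powr c * h x)"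
    using f by (rule jacobi_logE) blast
  obtain G where G: "G \<ge> 0" "\<And>x. -1 \<le> x \<Longrightarrow> x \<le> 1 \<Longrightarrow> \<bar>g x\<bar> \<le> G" using C_inf_on_bounded[OF gh(1)] by blast
  obtain H where H: "H \<ge> 0" "\<And>x. -1 \<le> x \<Longrightarrow> x \<le> 1 \<Longrightarrow> \<bar>h x\<bar> \<le> H" using C_inf_on_bounded[OF gh(2)] by blast
  define \<delta> where "\<delta> = real a - c'"
  have \<delta>: "\<delta> > 0" using assms by (simp add: \<delta>_def)
  define K where "K = 2 powr (b - b') * ((1 / \<delta> + 2 powr \<delta>) * G + 2 powr (c - c') * H)"
  show ?thesis
  proof (rule that[of K])
    show "K \<ge> 0" using G H \<delta> by (simp add: K_def)
    fix x :: real assume x: "-1 < x" "x < 1"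
    have A: "\<bar>(1 - x) ^ a * ln (1 - x) * g x\<bar> \<le> (1 / \<delta> + 2 powr \<delta>) * G * (1 - x) powr c'"
    proof -
      have "\<bar>(1 - x) ^ a * ln (1 - x) * g x\<bar> = (1 - x) powr real a * \<bar>ln (1 - x)\<bar> * \<bar>g x\<bar>"
        using x by (simp add: abs_mult powr_realpow)
      also have "\<dots> \<le> (1 - x) powr real a * ((1 / \<delta> + 2 powr \<delta>) * (1 - x) powr - \<delta>) * G"
        by (intro mult_mono mult_nonneg_nonneg abs_ln_le_powr) (use x G \<delta> in auto)
      also have "\<dots> = (1 / \<delta> + 2 powr \<delta>) * G * ((1 - x) powr real a * (1 - x) powr - \<delta>)" by (simp add: algebra_simps)
      also have "(1 - x) powr real a * (1 - x) powr - \<delta> = (1 - x) powr c'"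
        by (simp add: \<delta>_def flip: powr_add)
      finally show ?thesis .
    qed
    have B: "\<bar>(1 - x) powr c * h x\<bar> \<le> 2 powr (c - c') * H * (1 - x) powr c'"
    proof -
      have "\<bar>(1 - x) powr c * h x\<bar> = (1 - x) powr c * \<bar>h x\<bar>" using x by (simp add: abs_mult)
      also have "\<dots> \<le> (2 powr (c - c') * (1 - x) powr c') * H"
        by (intro mult_mono powr_le_powr_scaled) (use x H assms in auto)
      finally show ?thesis by (simp add: mult_ac)
    qed
    have "\<bar>f x\<bar> = (1 + x) powr b * \<bar>(1 - x) ^ a * ln (1 - x) * g x + (1 - x) powr c * h x\<bar>"
      using x by (simp add: eq abs_mult)
    also have "\<dots> \<le> (2 powr (b - b') * (1 + x) powr b') *
        ((1 / \<delta> + 2 powr \<delta>) * G * (1 - x) powr c' + 2 powr (c - c') * H * (1 - x) powr c')"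
      using A B by (intro mult_mono powr_le_powr_scaled) (use x assms in auto)
    also have "\<dots> = K * ((1 - x) powr c' * (1 + x) powr b')" by (simp add: K_def algebra_simps)
    finally show "\<bar>f x\<bar> \<le> K * ((1 - x) powr c' * (1 + x) powr b')" .
  qed
qed

section \<open>Integration by parts for Chebyshev coefficients\<close>

lemma abs_sin_multiple_le: "\<bar>sin (real m * t)\<bar> \<le> real m * \<bar>sin t\<bar>"
proof (induction m)
  case (Suc m)
  have "\<bar>sin (real (Suc m) * t)\<bar> = \<bar>sin (real m * t) * cos t + cos (real m * t) * sin t\<bar>"
    by (simp add: algebra_simps sin_add)
  also have "\<dots> \<le> \<bar>sin (real m * t)\<bar> * \<bar>cos t\<bar> + \<bar>cos (real m * t)\<bar> * \<bar>sin t\<bar>"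
    by (metis abs_mult abs_triangle_ineq)
  also have "\<dots> \<le> \<bar>sin (real m * t)\<bar> * 1 + 1 * \<bar>sin t\<bar>"
    by (intro add_mono mult_mono) auto
  finally show ?case using Suc by (simp add: algebra_simps)
qed auto

text \<open>
  With \<open>r = t / 4\<close> the left side is \<open>2 r\<^sup>2\<close> and the right side is \<open>2 sin\<^sup>2(2 r)\<close>. The inequality
  \<open>tan r \<ge> r\<close> gives \<open>sin(2 r) = 2 sin r cos r \<ge> 2 r cos\<^sup>2 r = r (1 + cos(2 r)) \<ge> r\<close>.
\<close>

lemma one_minus_cos_ge:
  assumes "0 \<le> t" "t \<le> pi" shows "t\<^sup>2 / 8 \<le> 1 - cos t"
proof -
  define r where "r = t / 4"
  have r: "0 \<le> r" "r \<le> pi / 4" "2 * (2 * r) = t" "2 * r \<le> pi / 2" using assms by (auto simp: r_def)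
  have "sin 0 - 0 * cos 0 \<le> sin r - r * cos r"
  proof (rule DERIV_nonneg_imp_nondecreasing[where f = "\<lambda>r. sin r - r * cos r"])
    fix y assume y: "0 \<le> y" "y \<le> r"
    have "((\<lambda>r. sin r - r * cos r) has_real_derivative y * sin y) (at y)"
      by (auto intro!: derivative_eq_intros)
    moreover have "y * sin y \<ge> 0" using y r by (intro mult_nonneg_nonneg sin_ge_zero) auto
    ultimately show "\<exists>z. ((\<lambda>r. sin r - r * cos r) has_real_derivative z) (at y) \<and> 0 \<le> z" by blast
  qed (use r in auto)
  hence s: "r * cos r \<le> sin r" by simp
  have c: "0 \<le> cos r" "0 \<le> cos (2 * r)" using r by (auto intro!: cos_ge_zero)
  have "r \<le> r * (1 + cos (2 * r))" using r c by (simp add: algebra_simps)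
  also have "\<dots> = 2 * (r * cos r) * cos r" by (simp add: cos_double_cos power2_eq_square)
  also have "\<dots> \<le> 2 * sin r * cos r" using s c by (intro mult_right_mono) auto
  also have "\<dots> = sin (2 * r)" by (simp add: sin_double)
  finally have "r\<^sup>2 \<le> (sin (2 * r))\<^sup>2" using r by (intro power_mono) auto
  moreover have "cos t = 1 - 2 * (sin (2 * r))\<^sup>2" using cos_double_sin[of "2 * r"] r by simp
  moreover have "t\<^sup>2 = 16 * r\<^sup>2" by (simp add: r_def power2_eq_square)
  ultimately show ?thesis by simp
qed

definition cheb_int :: "nat \<Rightarrow> (real \<Rightarrow> real) \<Rightarrow> real" where
  "cheb_int m f = integral {0..pi} (\<lambda>t. f (cos t) * cos (real m * t))"

text \<open>
  The frequency \<open>0\<close> is excluded: after the operator \<open>(1 - x\<^sup>2) f'' - x f'\<close> has been applied,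
  integrability comes from integration by parts, which needs a nonzero frequency.
\<close>

definition cheb_integrable :: "(real \<Rightarrow> real) \<Rightarrow> bool" where
  "cheb_integrable f \<longleftrightarrow> (\<forall>m\<ge>1. (\<lambda>t. f (cos t) * cos (real m * t)) integrable_on {0..pi})"

lemma cos_open_interval: "0 < t \<Longrightarrow> t < pi \<Longrightarrow> -1 < cos t \<and> cos t < 1"
  using cos_monotone_0_pi[of 0 t] cos_monotone_0_pi[of t pi] by simp_all

lemma sin_eq_powr_cos:
  assumes "0 < t" "t < pi"
  shows "sin t * ((1 - cos t) powr p * (1 + cos t) powr q) = (1 - cos t) powr (p + 1/2) * (1 + cos t) powr (q + 1/2)"
proof -
  have c: "-1 < cos t" "cos t < 1" using cos_open_interval assms by auto
  have "sin t = sqrt ((1 - cos t) * (1 + cos t))"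
    using assms sin_gt_zero[of t]
    by (intro real_sqrt_unique[symmetric]) (auto simp: sin_squared_eq algebra_simps power2_eq_square)
  also have "\<dots> = (1 - cos t) powr (1/2) * (1 + cos t) powr (1/2)"
    using c by (simp add: powr_half_sqrt real_sqrt_mult)
  finally show ?thesis by (simp add: powr_add algebra_simps)
qed

lemma continuous_on_vanishing_ends:
  assumes w: "continuous_on {0<..<pi} w" "w 0 = 0" "w pi = 0"
    and e: "\<epsilon> > 0" "\<eta> > 0"
    and b: "\<And>t. 0 < t \<Longrightarrow> t < pi \<Longrightarrow> \<bar>w t\<bar> \<le> K * ((1 - cos t) powr \<epsilon> * (1 + cos t) powr \<eta>)"
  shows "continuous_on {0..pi} w"
proof -
  define \<psi> where "\<psi> t = (1 - cos t) powr \<epsilon> * (1 + cos t) powr \<eta>" for t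
  have cos1: "1 - cos t \<ge> 0" "1 + cos t \<ge> 0" for t::real
    using cos_ge_minus_one[of t] cos_le_one[of t] by linarith+
  have cont: "continuous_on {0..pi} \<psi>"
    unfolding \<psi>_def using e by (intro continuous_intros continuous_on_powr') (auto intro: cos1)
  have z: "\<psi> 0 = 0" "\<psi> pi = 0" by (auto simp: \<psi>_def)
  have b': "\<bar>w t\<bar> \<le> K * \<psi> t" if "t \<in> {0..pi}" for t
    using that b[of t] w z unfolding \<psi>_def by (cases "t = 0 \<or> t = pi") auto
  have ends: "(w \<longlongrightarrow> 0) (at t within {0..pi})" if "t = 0 \<or> t = pi" for t
  proof (rule Lim_null_comparison)
    show "\<forall>\<^sub>F x in at t within {0..pi}. norm (w x) \<le> K * \<psi> x"
      using b' by (auto simp: eventually_at_filter)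
    have "(\<psi> \<longlongrightarrow> \<psi> t) (at t within {0..pi})"
      using cont that by (auto simp: continuous_on_def)
    hence "((\<lambda>x. K * \<psi> x) \<longlongrightarrow> K * \<psi> t) (at t within {0..pi})" by (intro tendsto_intros)
    thus "((\<lambda>x. K * \<psi> x) \<longlongrightarrow> 0) (at t within {0..pi})" using z that by auto
  qed
  show ?thesis
    unfolding continuous_on_def
  proof
    fix t assume t: "t \<in> {0..pi}"
    show "(w \<longlongrightarrow> w t) (at t within {0..pi})"
    proof (cases "t = 0 \<or> t = pi")
      case True thus ?thesis using ends w by auto
    next
      case False
      hence "t \<in> {0<..<pi}" using t by auto
      hence "isCont w t" using w(1) by (simp add: continuous_on_eq_continuous_at)
      thus ?thesis unfolding isCont_def by (rule tendsto_within_subset) simp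
    qed
  qed
qed

text \<open>
  The form in which integration by parts is used. Integrability of \<open>w'\<close> is part of the conclusion, so
  no separate argument is needed for integrands that are unbounded at the ends.
\<close>

lemma has_integral_deriv_vanishing_ends:
  assumes d: "\<And>t. 0 < t \<Longrightarrow> t < pi \<Longrightarrow> (w has_real_derivative w' t) (at t)"
    and e: "\<epsilon> > 0" "\<eta> > 0"
    and b: "\<And>t. 0 < t \<Longrightarrow> t < pi \<Longrightarrow> \<bar>w t\<bar> \<le> K * ((1 - cos t) powr \<epsilon> * (1 + cos t) powr \<eta>)"
  shows "(w' has_integral 0) {0..pi}"
proof -
  define v where "v t = (if t \<in> {0<..<pi} then w t else 0)" for t
  have dv: "(v has_real_derivative w' t) (at t)" if "t \<in> {0<..<pi}" for t
    by (rule has_field_derivative_transform_within_open[where f = w and S = "{0<..<pi}"])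
       (use that d in \<open>auto simp: v_def\<close>)
  have "continuous_on {0..pi} v"
  proof (rule continuous_on_vanishing_ends[OF _ _ _ e])
    show "continuous_on {0<..<pi} v"
      using dv by (meson DERIV_isCont continuous_at_imp_continuous_on)
  qed (use b in \<open>auto simp: v_def\<close>)
  hence "(w' has_integral (v pi - v 0)) {0..pi}"
    using dv by (intro fundamental_theorem_of_calculus_interior)
                (auto simp: has_real_derivative_iff_has_vector_derivative)
  thus ?thesis by (simp add: v_def)
qed

text \<open>
  Under the substitution \<open>x = cos t\<close> the factor \<open>sin t\<close> is \<open>(1 - x)\<^bsup>1/2\<^esup> (1 + x)\<^bsup>1/2\<^esup>\<close>. It therefore
  beats exponents above \<open>-1/2\<close>, which makes the boundary terms vanish.
\<close>

lemma jacobi_log_sin_bound: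
  assumes f: "jacobi_log a c b f" and "c > -1/2" "b > -1/2"
  obtains K \<eta> where "K \<ge> 0" "\<eta> > 0"
    "\<And>t. 0 < t \<Longrightarrow> t < pi \<Longrightarrow> sin t * \<bar>f (cos t)\<bar> \<le> K * ((1 - cos t) powr \<eta> * (1 + cos t) powr \<eta>)"
proof -
  define \<eta> where "\<eta> = min (1/4) (min (b + 1/2) (c + 1/2))"
  have \<eta>: "\<eta> > 0" "\<eta> - 1/2 \<le> b" "\<eta> - 1/2 \<le> c" "\<eta> - 1/2 < real a"
    using assms by (auto simp: \<eta>_def min_def)
  obtain K where K: "K \<ge> 0" "\<And>x. -1 < x \<Longrightarrow> x < 1 \<Longrightarrow> \<bar>f x\<bar> \<le> K * ((1 - x) powr (\<eta> - 1/2) * (1 + x) powr (\<eta> - 1/2))"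
    using jacobi_log_bound[OF f \<eta>(3,4,2)] by blast
  show ?thesis
  proof (rule that[OF K(1) \<eta>(1)])
    fix t :: real assume t: "0 < t" "t < pi"
    have c: "-1 < cos t" "cos t < 1" using cos_open_interval t by auto
    have "sin t * \<bar>f (cos t)\<bar> \<le> sin t * (K * ((1 - cos t) powr (\<eta> - 1/2) * (1 + cos t) powr (\<eta> - 1/2)))"
      using K(2)[OF c] sin_gt_zero[OF t] by (intro mult_left_mono) auto
    also have "\<dots> = K * (sin t * ((1 - cos t) powr (\<eta> - 1/2) * (1 + cos t) powr (\<eta> - 1/2)))" by simp
    finally show "sin t * \<bar>f (cos t)\<bar> \<le> K * ((1 - cos t) powr \<eta> * (1 + cos t) powr \<eta>)"
      by (subst (asm) sin_eq_powr_cos[OF t]) simp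
  qed
qed

lemma DERIV_comp_cos:
  assumes "\<And>x. -1 < x \<Longrightarrow> x < 1 \<Longrightarrow> (f has_real_derivative f' x) (at x)" "0 < t" "t < pi"
  shows "((\<lambda>t. f (cos t)) has_real_derivative - (sin t * f' (cos t))) (at t)"
proof -
  have "((\<lambda>t. f (cos t)) has_real_derivative f' (cos t) * (- sin t)) (at t)"
    using assms(1)[of "cos t"] cos_open_interval[OF assms(2,3)]
    by (intro DERIV_chain2[where g = cos]) (auto intro!: derivative_eq_intros)
  thus ?thesis by (simp add: mult.commute)
qed

lemma cheb_int_by_parts:
  assumes f: "jacobi_log a c b f" "c > -1/2" "b > -1/2"
    and d: "\<And>x. -1 < x \<Longrightarrow> x < 1 \<Longrightarrow> (f has_real_derivative f' x) (at x)"
    and int: "cheb_integrable f" and m: "m \<ge> 1"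
  shows "((\<lambda>t. sin t * f' (cos t) * sin (real m * t)) has_integral (real m * cheb_int m f)) {0..pi}"
proof -
  obtain K \<eta> where K: "K \<ge> 0" "\<eta> > 0"
    "\<And>t. 0 < t \<Longrightarrow> t < pi \<Longrightarrow> sin t * \<bar>f (cos t)\<bar> \<le> K * ((1 - cos t) powr \<eta> * (1 + cos t) powr \<eta>)"
    using jacobi_log_sin_bound[OF f] by blast
  have "((\<lambda>t. - (sin t * f' (cos t)) * sin (real m * t) + real m * (f (cos t) * cos (real m * t))) has_integral 0) {0..pi}"
  proof (rule has_integral_deriv_vanishing_ends[OF _ K(2) K(2), where w = "\<lambda>t. f (cos t) * sin (real m * t)" and K = "real m * K"])
    fix t :: real assume t: "0 < t" "t < pi"
    show "((\<lambda>t. f (cos t) * sin (real m * t)) has_real_derivative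
       - (sin t * f' (cos t)) * sin (real m * t) + real m * (f (cos t) * cos (real m * t))) (at t)"
      by (rule derivative_eq_intros DERIV_comp_cos[OF d t] refl | simp)+
    have "\<bar>f (cos t) * sin (real m * t)\<bar> \<le> \<bar>f (cos t)\<bar> * (real m * sin t)"
      using abs_sin_multiple_le[of m t] sin_gt_zero[OF t] by (simp add: abs_mult mult_left_mono)
    also have "\<dots> \<le> real m * (K * ((1 - cos t) powr \<eta> * (1 + cos t) powr \<eta>))"
      using mult_left_mono[OF K(3)[OF t], of "real m"] by (simp add: algebra_simps)
    finally show "\<bar>f (cos t) * sin (real m * t)\<bar> \<le> real m * K * ((1 - cos t) powr \<eta> * (1 + cos t) powr \<eta>)" by (simp add: mult_ac)
  qed
  moreover have "((\<lambda>t. real m * (f (cos t) * cos (real m * t))) has_integral (real m * cheb_int m f)) {0..pi}"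
    using int m unfolding cheb_integrable_def cheb_int_def
    by (intro has_integral_mult_right integrable_integral) auto
  ultimately have "((\<lambda>t. real m * (f (cos t) * cos (real m * t)) - (- (sin t * f' (cos t)) * sin (real m * t) + real m * (f (cos t) * cos (real m * t)))) has_integral (real m * cheb_int m f - 0)) {0..pi}"
    by (rule has_integral_diff[rotated])
  thus ?thesis by simp
qed

text \<open>
  Integrating by parts twice. The boundary terms are \<open>f(cos t) sin(m t)\<close> and
  \<open>sin t f'(cos t) cos(m t)\<close>, and the assumptions on \<open>a\<close>, \<open>b\<close> and \<open>b'\<close> are what makes them vanish at both ends.
\<close>

lemma cheb_int_step:
  assumes f: "jacobi_log a (real a) b f" and a: "a \<ge> 1" and b: "b \<ge> 0"
    and d: "b' = b - 1 \<or> b = 0 \<and> b' = 0" and b': "b' > -1/2"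
    and int: "cheb_integrable f"
  obtains F where "jacobi_log (a - 1) (real (a - 1)) b' F" "cheb_integrable F"
    "\<And>m. m \<ge> 1 \<Longrightarrow> cheb_int m F = - (real m)\<^sup>2 * cheb_int m f"
proof -
  obtain f' f'' where f': "jacobi_log (a - 1) (real a - 1) b' f'"
    "\<And>x. -1 < x \<Longrightarrow> x < 1 \<Longrightarrow> (f has_real_derivative f' x) (at x)"
    "\<And>x. -1 < x \<Longrightarrow> x < 1 \<Longrightarrow> (f' has_real_derivative f'' x) (at x)"
    "jacobi_log (a - 1) (real a - 1) b' (\<lambda>x. (1 - x\<^sup>2) * f'' x - x * f' x)"
    by (rule jacobi_log_cheb_op[OF f _ d, of 0]) auto
  define F where "F x = (1 - x\<^sup>2) * f'' x - x * f' x" for x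
  have ca: "real a - 1 > -1/2" using a by simp
  obtain K \<eta> where K: "K \<ge> 0" "\<eta> > 0"
    "\<And>t. 0 < t \<Longrightarrow> t < pi \<Longrightarrow> sin t * \<bar>f' (cos t)\<bar> \<le> K * ((1 - cos t) powr \<eta> * (1 + cos t) powr \<eta>)"
    using jacobi_log_sin_bound[OF f'(1) ca b'] by blast
  have main: "((\<lambda>t. F (cos t) * cos (real m * t)) has_integral (- (real m)\<^sup>2 * cheb_int m f)) {0..pi}" if m: "m \<ge> 1" for m
  proof -
    have "((\<lambda>t. - (F (cos t) * cos (real m * t)) - real m * (sin t * f' (cos t) * sin (real m * t))) has_integral 0) {0..pi}"
    proof (rule has_integral_deriv_vanishing_ends[OF _ K(2) K(2), where w = "\<lambda>t. sin t * f' (cos t) * cos (real m * t)" and K = K])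
      fix t :: real assume t: "0 < t" "t < pi"
      have "((\<lambda>t. sin t * f' (cos t) * cos (real m * t)) has_real_derivative
         ((cos t * f' (cos t) + sin t * (- (sin t * f'' (cos t)))) * cos (real m * t) + (sin t * f' (cos t)) * (- real m * sin (real m * t)))) (at t)"
        by (rule derivative_eq_intros DERIV_comp_cos[OF f'(3) t] refl | simp)+
      also have "sin t * (- (sin t * f'' (cos t))) = - ((1 - (cos t)\<^sup>2) * f'' (cos t))"
        by (simp add: sin_squared_eq[symmetric]) (simp add: power2_eq_square)
      finally show "((\<lambda>t. sin t * f' (cos t) * cos (real m * t)) has_real_derivative
         - (F (cos t) * cos (real m * t)) - real m * (sin t * f' (cos t) * sin (real m * t))) (at t)"
        by (simp add: F_def algebra_simps)
      have "\<bar>sin t * f' (cos t) * cos (real m * t)\<bar> \<le> sin t * \<bar>f' (cos t)\<bar> * 1"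
        unfolding abs_mult using sin_gt_zero[OF t] by (intro mult_mono) auto
      also have "\<dots> \<le> K * ((1 - cos t) powr \<eta> * (1 + cos t) powr \<eta>)" using K(3)[OF t] by simp
      finally show "\<bar>sin t * f' (cos t) * cos (real m * t)\<bar> \<le> K * ((1 - cos t) powr \<eta> * (1 + cos t) powr \<eta>)" .
    qed
    moreover have "((\<lambda>t. real m * (sin t * f' (cos t) * sin (real m * t))) has_integral (real m * (real m * cheb_int m f))) {0..pi}"
      by (intro has_integral_mult_right cheb_int_by_parts[OF f _ _ f'(2) int m]) (use a b in auto)
    ultimately have "((\<lambda>t. - ((- (F (cos t) * cos (real m * t)) - real m * (sin t * f' (cos t) * sin (real m * t))) + real m * (sin t * f' (cos t) * sin (real m * t)))) has_integral - (0 + real m * (real m * cheb_int m f))) {0..pi}"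
      by (intro has_integral_neg has_integral_add)
    thus ?thesis by (simp add: power2_eq_square mult_ac)
  qed
  show ?thesis
  proof (rule that[of F])
    show "jacobi_log (a - 1) (real (a - 1)) b' F" using f'(4) a by (simp add: F_def[abs_def] of_nat_diff)
    show "cheb_integrable F" unfolding cheb_integrable_def using main by blast
    show "cheb_int m F = - (real m)\<^sup>2 * cheb_int m f" if "m \<ge> 1" for m
      using main[OF that] by (simp add: cheb_int_def integral_unique)
  qed
qed

lemma cheb_int_iterate:
  assumes "jacobi_log (a + k) (real (a + k)) b f" "cheb_integrable f"
    and "b = 0 \<and> b' = 0 \<or> b' = b - real k \<and> b' > -1/2 \<and> b \<ge> 0"
  shows "\<exists>F. jacobi_log a (real a) b' F \<and> cheb_integrable F \<and>
    (\<forall>m\<ge>1. \<bar>cheb_int m F\<bar> = real m ^ (2 * k) * \<bar>cheb_int m f\<bar>)"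
  using assms
proof (induction k arbitrary: f b)
  case 0
  thus ?case by auto
next
  case (Suc k)
  define b1 where "b1 = (if b = 0 \<and> b' = 0 then 0 else b - 1)"
  have b1: "b1 = b - 1 \<or> b = 0 \<and> b1 = 0" "b1 > -1/2" "b \<ge> 0" using Suc.prems(3) by (auto simp: b1_def)
  have b1': "b1 = 0 \<and> b' = 0 \<or> b' = b1 - real k \<and> b' > -1/2 \<and> b1 \<ge> 0 \<or> k = 0"
    using Suc.prems(3) by (auto simp: b1_def)
  obtain F1 where F1: "jacobi_log (a + Suc k - 1) (real (a + Suc k - 1)) b1 F1" "cheb_integrable F1"
    "\<And>m. m \<ge> 1 \<Longrightarrow> cheb_int m F1 = - (real m)\<^sup>2 * cheb_int m f"
    by (rule cheb_int_step[OF Suc.prems(1) _ b1(3,1,2) Suc.prems(2)]) auto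
  show ?case
  proof (cases "k = 0")
    case True
    have "b' = b1" using Suc.prems(3) True by (auto simp: b1_def)
    thus ?thesis using F1 True by (intro exI[of _ F1]) (auto simp: abs_mult)
  next
    case False
    obtain F where F: "jacobi_log a (real a) b' F" "cheb_integrable F"
      "\<forall>m\<ge>1. \<bar>cheb_int m F\<bar> = real m ^ (2 * k) * \<bar>cheb_int m F1\<bar>"
      using Suc.IH[of b1 F1] F1(1,2) b1' False by auto
    thus ?thesis using F1(3) by (intro exI[of _ F]) (auto simp: abs_mult power_add power2_eq_square algebra_simps)
  qed
qed

section \<open>Decay of Chebyshev coefficients\<close>

text \<open>
  An integrand of size \<open>t\<^bsup>\<tau>-1\<^esup>\<close> near \<open>0\<close> is cut at \<open>\<epsilon> = 1/m\<close>. On \<open>[0, \<epsilon>]\<close> the bound \<open>\<bar>sin(m t)\<bar> \<le> m t\<close>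
  makes even \<open>\<tau> = 0\<close> integrable. On \<open>[\<epsilon>, \<pi>]\<close> two integrations by parts are possible, and each
  boundary term at \<open>\<epsilon>\<close> as well as the remaining integral is of size \<open>\<epsilon>\<^sup>\<tau>\<close>. Since \<open>\<phi>\<close> and
  \<open>sin(m t)\<close> vanish at \<open>\<pi>\<close>, that end contributes no boundary terms.
\<close>

lemma oscillatory_integral_bound:
  fixes \<phi> \<phi>' \<phi>'' :: "real \<Rightarrow> real"
  assumes \<tau>: "0 \<le> \<tau>" "\<tau> < 2" and C: "C \<ge> 0"
    and d1: "\<And>t. 0 < t \<Longrightarrow> t < pi \<Longrightarrow> (\<phi> has_real_derivative \<phi>' t) (at t)"
    and d2: "\<And>t. 0 < t \<Longrightarrow> t < pi \<Longrightarrow> (\<phi>' has_real_derivative \<phi>'' t) (at t)"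
    and b0: "\<And>t. 0 < t \<Longrightarrow> t < pi \<Longrightarrow> \<bar>\<phi> t\<bar> \<le> C * t powr (\<tau> - 1)"
    and b1: "\<And>t. 0 < t \<Longrightarrow> t < pi \<Longrightarrow> \<bar>\<phi>' t\<bar> \<le> C * t powr (\<tau> - 2)"
    and b2: "\<And>t. 0 < t \<Longrightarrow> t < pi \<Longrightarrow> \<bar>\<phi>'' t\<bar> \<le> C * t powr (\<tau> - 3)"
    and lim: "(\<phi> \<longlongrightarrow> 0) (at_left pi)"
    and int: "(\<lambda>t. \<phi> t * sin (real m * t)) integrable_on {0..pi}" and m: "m \<ge> 1"
  shows "\<bar>integral {0..pi} (\<lambda>t. \<phi> t * sin (real m * t))\<bar> \<le> C * (3 + 1 / (2 - \<tau>)) * real m powr - \<tau>"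
proof -
  define \<epsilon> where "\<epsilon> = 1 / real m"
  have "\<epsilon> \<le> 1" using m by (simp add: \<epsilon>_def)
  hence \<epsilon>: "0 < \<epsilon>" "\<epsilon> < pi" using m pi_gt3 by (simp add: \<epsilon>_def, linarith)
  have me: "real m = \<epsilon> powr -1" "real m powr - \<tau> = \<epsilon> powr \<tau>"
    using m by (simp_all add: \<epsilon>_def powr_minus_divide powr_divide)
  let ?g = "\<lambda>t. \<phi> t * sin (real m * t)"
  have int1: "?g integrable_on {0..\<epsilon>}" and int2: "?g integrable_on {\<epsilon>..pi}"
    by (rule integrable_on_subinterval[OF int], use \<epsilon> in auto)+
  have pw: "\<epsilon> powr p * \<epsilon> powr q = \<epsilon> powr (p + q)" for p q by (simp add: powr_add)
  have near: "\<bar>integral {0..\<epsilon>} ?g\<bar> \<le> C * \<epsilon> powr \<tau>"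
  proof -
    have I: "((\<lambda>t. C * real m * t powr \<tau>) has_integral (C * real m * (\<epsilon> powr (\<tau> + 1) / (\<tau> + 1)))) {0..\<epsilon>}"
      by (intro has_integral_mult_right has_integral_powr_from_0) (use \<tau> \<epsilon> in auto)
    have "norm (integral {0..\<epsilon>} ?g) \<le> integral {0..\<epsilon>} (\<lambda>t. C * real m * t powr \<tau>)"
    proof (rule integral_norm_bound_integral[OF int1])
      show "(\<lambda>t. C * real m * t powr \<tau>) integrable_on {0..\<epsilon>}" using I by blast
      fix t assume t: "t \<in> {0..\<epsilon>}"
      show "norm (?g t) \<le> C * real m * t powr \<tau>"
      proof (cases "t = 0")
        case False
        hence t': "0 < t" "t < pi" using t \<epsilon> by auto
        have "norm (?g t) = \<bar>\<phi> t\<bar> * \<bar>sin (real m * t)\<bar>" by (simp add: abs_mult)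
        also have "\<dots> \<le> (C * t powr (\<tau> - 1)) * (real m * t)"
          using b0[OF t'] abs_sin_x_le_abs_x[of "real m * t"] t' by (intro mult_mono) auto
        also have "t powr (\<tau> - 1) = t powr \<tau> / t" using t' by (simp add: powr_diff)
        finally show ?thesis using t' by (simp add: mult_ac)
      qed (use C in simp)
    qed
    also have "\<dots> = C * (real m * \<epsilon> powr (\<tau> + 1)) / (\<tau> + 1)"
      unfolding integral_unique[OF I] by simp
    also have "real m * \<epsilon> powr (\<tau> + 1) = \<epsilon> powr \<tau>" unfolding me pw by simp
    also have "C * \<epsilon> powr \<tau> / (\<tau> + 1) \<le> C * \<epsilon> powr \<tau> / 1"
      using C \<tau> by (intro divide_left_mono) auto
    finally show ?thesis by simp
  qed
  \<comment> \<open>the antiderivative produced by the two integrations by parts; its formula is not meaningful at \<open>\<pi>\<close>, where its limit is \<open>0\<close>\<close>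
  define \<Psi> where "\<Psi> t = (if t = pi then 0 else - (\<phi> t * cos (real m * t)) / real m + \<phi>' t * sin (real m * t) / (real m)\<^sup>2)" for t
  let ?h = "\<lambda>t. \<phi>'' t * sin (real m * t) / (real m)\<^sup>2"
  have d\<Psi>: "(\<Psi> has_real_derivative ?g t + ?h t) (at t)" if t: "0 < t" "t < pi" for t
  proof (rule has_field_derivative_transform_within_open[where S = "{0<..<pi}"])
    show "((\<lambda>t. - (\<phi> t * cos (real m * t)) / real m + \<phi>' t * sin (real m * t) / (real m)\<^sup>2) has_real_derivative ?g t + ?h t) (at t)"
    proof -
      have "((\<lambda>t. - (\<phi> t * cos (real m * t)) / real m + \<phi>' t * sin (real m * t) / (real m)\<^sup>2) has_real_derivative
          - (\<phi>' t * cos (real m * t) + (- sin (real m * t) * real m) * \<phi> t) / real m +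
          (\<phi>'' t * sin (real m * t) + (cos (real m * t) * real m) * \<phi>' t) / (real m)\<^sup>2) (at t)"
        by (intro DERIV_add DERIV_cdivide DERIV_minus DERIV_mult d1[OF t] d2[OF t])
           (auto intro!: derivative_eq_intros)
      also have "- (\<phi>' t * cos (real m * t) + (- sin (real m * t) * real m) * \<phi> t) / real m +
          (\<phi>'' t * sin (real m * t) + (cos (real m * t) * real m) * \<phi>' t) / (real m)\<^sup>2 = ?g t + ?h t"
        using m by (simp add: field_simps power2_eq_square)
      finally show ?thesis .
    qed
  qed (use t in \<open>auto simp: \<Psi>_def\<close>)
  have cont: "continuous_on {\<epsilon>..pi} \<Psi>"
    unfolding continuous_on_def
  proof
    fix t assume t: "t \<in> {\<epsilon>..pi}"
    show "(\<Psi> \<longlongrightarrow> \<Psi> t) (at t within {\<epsilon>..pi})"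
    proof (cases "t = pi")
      case False
      hence "isCont \<Psi> t" using d\<Psi>[of t] t \<epsilon> by (intro DERIV_isCont) auto
      thus ?thesis unfolding isCont_def by (rule tendsto_within_subset) simp
    next
      case True
      have at: "at pi within {\<epsilon>..pi} = at_left pi" by (rule at_within_Icc_at_left) (use \<epsilon> in auto)
      have ev: "\<forall>\<^sub>F x in at_left pi. \<epsilon> < x \<and> x < pi"
        using \<epsilon> by (auto simp: eventually_at_left_field)
      have "((\<lambda>t. - (\<phi> t * cos (real m * t)) / real m) \<longlongrightarrow> - (0 * cos (real m * pi)) / real m) (at_left pi)"
        by (intro tendsto_intros lim) (use m in auto)
      moreover have "((\<lambda>t. \<phi>' t * sin (real m * t)) \<longlongrightarrow> 0) (at_left pi)"
      proof (rule Lim_null_comparison)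
        show "\<forall>\<^sub>F x in at_left pi. norm (\<phi>' x * sin (real m * x)) \<le> C * \<epsilon> powr (\<tau> - 2) * \<bar>sin (real m * x)\<bar>"
          using ev
        proof eventually_elim
          case (elim x)
          have "\<bar>\<phi>' x\<bar> \<le> C * x powr (\<tau> - 2)" using b1 elim \<epsilon> by auto
          also have "\<dots> \<le> C * \<epsilon> powr (\<tau> - 2)"
            using elim \<epsilon> C \<tau> by (intro mult_left_mono powr_mono2') auto
          finally show ?case by (simp add: abs_mult mult_right_mono)
        qed
        have "((\<lambda>x. C * \<epsilon> powr (\<tau> - 2) * \<bar>sin (real m * x)\<bar>) \<longlongrightarrow> C * \<epsilon> powr (\<tau> - 2) * \<bar>sin (real m * pi)\<bar>) (at_left pi)"
          by (intro tendsto_intros)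
        thus "((\<lambda>x. C * \<epsilon> powr (\<tau> - 2) * \<bar>sin (real m * x)\<bar>) \<longlongrightarrow> 0) (at_left pi)" by simp
      qed
      hence "((\<lambda>t. \<phi>' t * sin (real m * t) / (real m)\<^sup>2) \<longlongrightarrow> 0 / (real m)\<^sup>2) (at_left pi)"
        by (intro tendsto_intros) (use m in auto)
      ultimately have "((\<lambda>t. - (\<phi> t * cos (real m * t)) / real m + \<phi>' t * sin (real m * t) / (real m)\<^sup>2) \<longlongrightarrow> 0) (at_left pi)"
        using tendsto_add by fastforce
      moreover have "\<forall>\<^sub>F x in at_left pi. - (\<phi> x * cos (real m * x)) / real m + \<phi>' x * sin (real m * x) / (real m)\<^sup>2 = \<Psi> x"
        using ev by eventually_elim (auto simp: \<Psi>_def)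
      ultimately have "(\<Psi> \<longlongrightarrow> 0) (at_left pi)" by (rule Lim_transform_eventually)
      thus ?thesis using True at by (simp add: \<Psi>_def)
    qed
  qed
  have "((\<lambda>t. ?g t + ?h t) has_integral (\<Psi> pi - \<Psi> \<epsilon>)) {\<epsilon>..pi}"
    using d\<Psi> \<epsilon> cont by (intro fundamental_theorem_of_calculus_interior)
                (auto simp: has_real_derivative_iff_has_vector_derivative)
  hence "((\<lambda>t. ?g t + ?h t - ?g t) has_integral (\<Psi> pi - \<Psi> \<epsilon> - integral {\<epsilon>..pi} ?g)) {\<epsilon>..pi}"
    by (intro has_integral_diff integrable_integral int2)
  hence hint: "(?h has_integral (- \<Psi> \<epsilon> - integral {\<epsilon>..pi} ?g)) {\<epsilon>..pi}"
    by (simp add: \<Psi>_def)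
  have far: "\<bar>integral {\<epsilon>..pi} ?h\<bar> \<le> C * (1 / (2 - \<tau>)) * \<epsilon> powr \<tau>"
  proof -
    have I: "((\<lambda>t. C / (real m)\<^sup>2 * t powr (\<tau> - 3)) has_integral (C / (real m)\<^sup>2 * (pi powr (\<tau> - 2) / (\<tau> - 2) - \<epsilon> powr (\<tau> - 2) / (\<tau> - 2)))) {\<epsilon>..pi}"
    proof (intro has_integral_mult_right fundamental_theorem_of_calculus)
      fix x assume x: "x \<in> {\<epsilon>..pi}"
      have "((\<lambda>t. t powr (\<tau> - 2) / (\<tau> - 2)) has_real_derivative x powr (\<tau> - 3)) (at x)"
        using x \<epsilon> \<tau> by (auto intro!: derivative_eq_intros)
      thus "((\<lambda>t. t powr (\<tau> - 2) / (\<tau> - 2)) has_vector_derivative x powr (\<tau> - 3)) (at x within {\<epsilon>..pi})"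
        by (simp add: has_field_derivative_at_within has_real_derivative_iff_has_vector_derivative[symmetric])
    qed (use \<epsilon> in auto)
    have "norm (integral {\<epsilon>..pi} ?h) \<le> integral {\<epsilon>..pi} (\<lambda>t. C / (real m)\<^sup>2 * t powr (\<tau> - 3))"
    proof (rule integral_norm_bound_integral)
      show "?h integrable_on {\<epsilon>..pi}" using hint by blast
      show "(\<lambda>t. C / (real m)\<^sup>2 * t powr (\<tau> - 3)) integrable_on {\<epsilon>..pi}" using I by blast
      fix t assume t: "t \<in> {\<epsilon>..pi}"
      show "norm (?h t) \<le> C / (real m)\<^sup>2 * t powr (\<tau> - 3)"
      proof (cases "t = pi")
        case False
        have "\<bar>\<phi>'' t\<bar> * \<bar>sin (real m * t)\<bar> \<le> (C * t powr (\<tau> - 3)) * 1"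
          using b2[of t] t False \<epsilon> C by (intro mult_mono) auto
        thus ?thesis using m by (simp add: abs_mult divide_right_mono)
      next
        case True
        have "sin (real m * pi) = 0" by simp
        thus ?thesis using True C by simp
      qed
    qed
    also have "\<dots> = C / (real m)\<^sup>2 * (pi powr (\<tau> - 2) / (\<tau> - 2) - \<epsilon> powr (\<tau> - 2) / (\<tau> - 2))"
      by (rule integral_unique[OF I])
    also have "\<dots> \<le> C / (real m)\<^sup>2 * (\<epsilon> powr (\<tau> - 2) / (2 - \<tau>))"
    proof (intro mult_left_mono)
      have "pi powr (\<tau> - 2) / (\<tau> - 2) \<le> 0" using \<tau> by (intro divide_nonneg_neg) auto
      moreover have "\<epsilon> powr (\<tau> - 2) / (2 - \<tau>) = - (\<epsilon> powr (\<tau> - 2) / (\<tau> - 2))" 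
        by (metis minus_diff_eq minus_divide_right)
      ultimately show "pi powr (\<tau> - 2) / (\<tau> - 2) - \<epsilon> powr (\<tau> - 2) / (\<tau> - 2) \<le> \<epsilon> powr (\<tau> - 2) / (2 - \<tau>)" by simp
    qed (use C in auto)
    also have "\<dots> = C * (1 / (2 - \<tau>)) * (\<epsilon> powr 2 * \<epsilon> powr (\<tau> - 2))"
      using \<epsilon> by (simp add: \<epsilon>_def power_divide field_simps)
    also have "\<epsilon> powr 2 * \<epsilon> powr (\<tau> - 2) = \<epsilon> powr \<tau>" unfolding pw by simp
    finally show ?thesis by simp
  qed
  have bd: "\<bar>\<Psi> \<epsilon>\<bar> \<le> 2 * C * \<epsilon> powr \<tau>"
  proof -
    have "\<bar>\<Psi> \<epsilon>\<bar> \<le> \<bar>\<phi> \<epsilon>\<bar> * \<bar>cos (real m * \<epsilon>)\<bar> / real m + \<bar>\<phi>' \<epsilon>\<bar> * \<bar>sin (real m * \<epsilon>)\<bar> / (real m)\<^sup>2"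
    proof -
      have "\<bar>\<Psi> \<epsilon>\<bar> \<le> \<bar>- (\<phi> \<epsilon> * cos (real m * \<epsilon>)) / real m\<bar> + \<bar>\<phi>' \<epsilon> * sin (real m * \<epsilon>) / (real m)\<^sup>2\<bar>"
        using \<epsilon> unfolding \<Psi>_def by (simp only: abs_triangle_ineq if_False less_irrefl split: if_splits) simp
      thus ?thesis by (simp add: abs_mult)
    qed
    also have "\<dots> \<le> (C * \<epsilon> powr (\<tau> - 1)) * 1 / real m + (C * \<epsilon> powr (\<tau> - 2)) * 1 / (real m)\<^sup>2"
      using b0[OF \<epsilon>] b1[OF \<epsilon>] C by (intro add_mono divide_right_mono mult_mono) auto
    also have "\<dots> = C * (\<epsilon> powr 1 * \<epsilon> powr (\<tau> - 1)) + C * (\<epsilon> powr 2 * \<epsilon> powr (\<tau> - 2))"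
      using \<epsilon> by (simp add: \<epsilon>_def power_divide field_simps)
    also have "\<dots> = 2 * C * \<epsilon> powr \<tau>" unfolding pw by simp
    finally show ?thesis .
  qed
  have "integral {0..pi} ?g = integral {0..\<epsilon>} ?g + integral {\<epsilon>..pi} ?g"
    by (rule Henstock_Kurzweil_Integration.integral_combine[symmetric, OF _ _ int]) (use \<epsilon> in auto)
  also have "integral {\<epsilon>..pi} ?g = - \<Psi> \<epsilon> - integral {\<epsilon>..pi} ?h"
    using integral_unique[OF hint] by simp
  finally have "\<bar>integral {0..pi} ?g\<bar> \<le> \<bar>integral {0..\<epsilon>} ?g\<bar> + \<bar>\<Psi> \<epsilon>\<bar> + \<bar>integral {\<epsilon>..pi} ?h\<bar>" by linarith
  also have "\<dots> \<le> C * \<epsilon> powr \<tau> + 2 * C * \<epsilon> powr \<tau> + C * (1 / (2 - \<tau>)) * \<epsilon> powr \<tau>"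
    by (intro add_mono near bd far)
  also have "\<dots> = C * (3 + 1 / (2 - \<tau>)) * real m powr - \<tau>"
    unfolding me(2) by (simp add: algebra_simps)
  finally show ?thesis .
qed

lemma one_minus_cos_powr_le:
  assumes "0 < t" "t < pi" "p \<le> 0"
  shows "(1 - cos t) powr p \<le> 8 powr (- p) * t powr (2 * p)"
proof -
  have "(1 - cos t) powr p \<le> (t\<^sup>2 / 8) powr p"
    using one_minus_cos_ge[of t] assms by (intro powr_mono2') auto
  also have "\<dots> = 8 powr (- p) * (t powr 2) powr p"
    using assms by (simp add: powr_divide powr_minus_divide)
  also have "(t powr 2) powr p = t powr (2 * p)" by (rule powr_powr)
  finally show ?thesis .
qed

text \<open>
  The previous estimate in the variable \<open>x = cos t\<close>, with the singular end at \<open>x = 1\<close>. Near that end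
  \<open>1 - x\<close> behaves like \<open>t\<^sup>2 / 2\<close>, so that \<open>\<sigma>\<close> becomes \<open>\<tau> = 2 \<sigma>\<close>. The functions \<open>q\<close> and
  \<open>- sin t q'(cos t)\<close> are the first two derivatives of \<open>sin t p(cos t)\<close> with respect to \<open>t\<close>.
\<close>

lemma endpoint_oscillatory_bound:
  fixes p p' q' :: "real \<Rightarrow> real" and \<sigma> K :: real
  defines "q \<equiv> \<lambda>x. x * p x - (1 - x\<^sup>2) * p' x"
  assumes \<sigma>: "0 \<le> \<sigma>" "\<sigma> < 1" and K: "K \<ge> 0"
    and dp: "\<And>x. -1 < x \<Longrightarrow> x < 1 \<Longrightarrow> (p has_real_derivative p' x) (at x)"
    and dq: "\<And>x. -1 < x \<Longrightarrow> x < 1 \<Longrightarrow> (q has_real_derivative q' x) (at x)"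
    and bp: "\<And>x. -1 < x \<Longrightarrow> x < 1 \<Longrightarrow> \<bar>p x\<bar> \<le> K * (1 - x) powr (\<sigma> - 1)"
    and bq: "\<And>x. -1 < x \<Longrightarrow> x < 1 \<Longrightarrow> \<bar>q x\<bar> \<le> K * (1 - x) powr (\<sigma> - 1)"
    and bq': "\<And>x. -1 < x \<Longrightarrow> x < 1 \<Longrightarrow> \<bar>q' x\<bar> \<le> K * (1 - x) powr (\<sigma> - 2)"
    and int: "\<And>m. m \<ge> 1 \<Longrightarrow> (\<lambda>t. sin t * p (cos t) * sin (real m * t)) integrable_on {0..pi}"
  shows "\<exists>C. \<forall>m\<ge>1. \<bar>integral {0..pi} (\<lambda>t. sin t * p (cos t) * sin (real m * t))\<bar> \<le> C * real m powr (- 2 * \<sigma>)"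
proof -
  define C where "C = K * 8 powr (2 - \<sigma>)"
  have C: "C \<ge> 0" "K * 8 powr (1 - \<sigma>) \<le> C" 
    using K by (auto simp: C_def intro!: mult_left_mono)
  have low: "K * (1 - cos t) powr (\<sigma> - 1) \<le> C * t powr (2 * \<sigma> - 2)" if t: "0 < t" "t < pi" for t
  proof -
    have "K * (1 - cos t) powr (\<sigma> - 1) \<le> K * (8 powr (- (\<sigma> - 1)) * t powr (2 * (\<sigma> - 1)))"
      using one_minus_cos_powr_le[OF t, of "\<sigma> - 1"] K \<sigma> by (intro mult_left_mono) auto
    also have "\<dots> = (K * 8 powr (1 - \<sigma>)) * t powr (2 * \<sigma> - 2)" by (simp add: algebra_simps)
    also have "\<dots> \<le> C * t powr (2 * \<sigma> - 2)" using C by (intro mult_right_mono) auto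
    finally show ?thesis .
  qed
  have low2: "K * (1 - cos t) powr (\<sigma> - 2) \<le> C * t powr (2 * \<sigma> - 4)" if t: "0 < t" "t < pi" for t
  proof -
    have "K * (1 - cos t) powr (\<sigma> - 2) \<le> K * (8 powr (- (\<sigma> - 2)) * t powr (2 * (\<sigma> - 2)))"
      using one_minus_cos_powr_le[OF t, of "\<sigma> - 2"] K \<sigma> by (intro mult_left_mono) auto
    also have "\<dots> = C * t powr (2 * \<sigma> - 4)" by (simp add: C_def algebra_simps)
    finally show ?thesis .
  qed
  have st: "sin t * t powr r \<le> t powr (r + 1)" if t: "0 < t" "t < pi" for t r :: real
  proof -
    have "sin t * t powr r \<le> t * t powr r" using t sin_x_le_x[of t] by (intro mult_right_mono) auto
    also have "\<dots> = t powr (r + 1)" using t by (simp add: powr_add)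
    finally show ?thesis .
  qed
  have stC: "sin t * \<bar>y\<bar> \<le> C * t powr (r + 1)" if t: "0 < t" "t < pi" and y: "\<bar>y\<bar> \<le> C * t powr r" for t r y :: real
  proof -
    have "sin t * \<bar>y\<bar> \<le> sin t * (C * t powr r)" using sin_gt_zero[OF t] y by (intro mult_left_mono) auto
    also have "\<dots> = C * (sin t * t powr r)" by simp
    also have "\<dots> \<le> C * t powr (r + 1)" using st[OF t] C by (intro mult_left_mono) auto
    finally show ?thesis .
  qed
  have bound_p: "\<bar>p (cos t)\<bar> \<le> C * t powr (2 * \<sigma> - 2)" if t: "0 < t" "t < pi" for t
    using bp[of "cos t"] low[OF t] cos_open_interval[OF t] by linarith
  have bound_q: "\<bar>q (cos t)\<bar> \<le> C * t powr (2 * \<sigma> - 2)" if t: "0 < t" "t < pi" for t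
    using bq[of "cos t"] low[OF t] cos_open_interval[OF t] by linarith
  have bound_q': "\<bar>q' (cos t)\<bar> \<le> C * t powr (2 * \<sigma> - 4)" if t: "0 < t" "t < pi" for t
    using bq'[of "cos t"] low2[OF t] cos_open_interval[OF t] by linarith
  have d1: "((\<lambda>t. sin t * p (cos t)) has_real_derivative q (cos t)) (at t)" if t: "0 < t" "t < pi" for t
  proof -
    have "((\<lambda>t. sin t * p (cos t)) has_real_derivative cos t * p (cos t) + (- (sin t * p' (cos t))) * sin t) (at t)"
      by (intro DERIV_mult DERIV_comp_cos[OF dp t] DERIV_sin)
    also have "cos t * p (cos t) + (- (sin t * p' (cos t))) * sin t = q (cos t)"
      unfolding q_def sin_squared_eq[symmetric] by (simp add: power2_eq_square)
    finally show ?thesis .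
  qed
  have lim: "((\<lambda>t. sin t * p (cos t)) \<longlongrightarrow> 0) (at_left pi)"
  proof (rule Lim_null_comparison)
    have "\<forall>\<^sub>F t in at_left pi. 1 < t \<and> t < pi"
      using pi_gt3 by (auto simp: eventually_at_left_field intro!: exI[of _ 1])
    thus "\<forall>\<^sub>F t in at_left pi. norm (sin t * p (cos t)) \<le> C * 1 * sin t"
    proof eventually_elim
      case (elim t)
      have "\<bar>p (cos t)\<bar> \<le> C * t powr (2 * \<sigma> - 2)" using bound_p elim by simp
      also have "t powr (2 * \<sigma> - 2) \<le> 1 powr (2 * \<sigma> - 2)" using elim \<sigma> by (intro powr_mono2') auto
      finally have "\<bar>p (cos t)\<bar> \<le> C * 1" using C by (simp add: mult_left_mono)
      moreover have "sin t > 0" using elim by (intro sin_gt_zero) auto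
      ultimately show ?case by (simp add: abs_mult mult.commute mult_left_mono)
    qed
    have "((\<lambda>t. C * 1 * sin t) \<longlongrightarrow> C * 1 * sin pi) (at_left pi)" by (intro tendsto_intros)
    thus "((\<lambda>t. C * 1 * sin t) \<longlongrightarrow> 0) (at_left pi)" by simp
  qed
  have "\<bar>integral {0..pi} (\<lambda>t. sin t * p (cos t) * sin (real m * t))\<bar> \<le> C * (3 + 1 / (2 - 2 * \<sigma>)) * real m powr - (2 * \<sigma>)"
    if m: "m \<ge> 1" for m
  proof (rule oscillatory_integral_bound[OF _ _ C(1) d1 _ _ _ _ lim int[OF m] m])
    fix t :: real assume t: "0 < t" "t < pi"
    show "((\<lambda>t. q (cos t)) has_real_derivative - (sin t * q' (cos t))) (at t)"
      by (rule DERIV_comp_cos[OF dq t])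
    show "\<bar>sin t * p (cos t)\<bar> \<le> C * t powr (2 * \<sigma> - 1)"
      using stC[OF t bound_p[OF t]] sin_gt_zero[OF t] by (simp add: abs_mult)
    show "\<bar>q (cos t)\<bar> \<le> C * t powr (2 * \<sigma> - 2)" by (rule bound_q[OF t])
    show "\<bar>- (sin t * q' (cos t))\<bar> \<le> C * t powr (2 * \<sigma> - 3)"
      using stC[OF t bound_q'[OF t]] sin_gt_zero[OF t] by (simp add: abs_mult)
  qed (use \<sigma> in auto)
  thus ?thesis by (intro exI[of _ "C * (3 + 1 / (2 - 2 * \<sigma>))"]) simp
qed

text \<open>
  This is the case \<open>\<sigma> = 0\<close> with \<open>p = f'\<close>. The first derivative has a simple pole at \<open>1\<close> without
  logarithm. The assumption on \<open>b\<close> keeps everything bounded near \<open>-1\<close> up to the third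
  derivative.
\<close>

lemma cheb_int_log_bound:
  assumes f: "jacobi_log 0 0 b f" and b: "b = 0 \<or> b \<ge> 2" and int: "cheb_integrable f"
  shows "\<exists>C. \<forall>m\<ge>1. \<bar>cheb_int m f\<bar> \<le> C * real m powr (-1)"
proof -
  define b1 where "b1 = (if b = 0 then 0 else b - 1)"
  define b2 where "b2 = (if b = 0 then 0 else b - 2)"
  have d: "b1 = b - 1 \<or> b = 0 \<and> b1 = 0" "b2 = b1 - 1 \<or> b1 = 0 \<and> b2 = 0" "0 \<le> b1" "0 \<le> b2"
    using b by (auto simp: b1_def b2_def)
  obtain f' f'' where f': "jacobi_log 0 (-1) b1 f'"
    "\<And>x. -1 < x \<Longrightarrow> x < 1 \<Longrightarrow> (f has_real_derivative f' x) (at x)"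
    "\<And>x. -1 < x \<Longrightarrow> x < 1 \<Longrightarrow> (f' has_real_derivative f'' x) (at x)"
    "jacobi_log 0 (-1) b1 (\<lambda>x. (1 - x\<^sup>2) * f'' x - x * f' x)"
    by (rule jacobi_log_cheb_op[OF f _ d(1), of 0]) auto
  obtain r where r: "jacobi_log 0 (-2) b2 r"
    "\<And>x. -1 < x \<Longrightarrow> x < 1 \<Longrightarrow> ((\<lambda>x. (1 - x\<^sup>2) * f'' x - x * f' x) has_real_derivative r x) (at x)"
    by (rule jacobi_log_deriv[OF f'(4) _ d(2), of 1]) auto
  obtain K1 where K1: "K1 \<ge> 0" "\<And>x. -1 < x \<Longrightarrow> x < 1 \<Longrightarrow> \<bar>f' x\<bar> \<le> K1 * ((1 - x) powr (-1) * (1 + x) powr 0)"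
    using jacobi_log_bound[OF f'(1) order.refl _ d(3)] by auto
  obtain K2 where K2: "K2 \<ge> 0" "\<And>x. -1 < x \<Longrightarrow> x < 1 \<Longrightarrow> \<bar>(1 - x\<^sup>2) * f'' x - x * f' x\<bar> \<le> K2 * ((1 - x) powr (-1) * (1 + x) powr 0)"
    using jacobi_log_bound[OF f'(4) order.refl _ d(3)] by auto
  obtain K3 where K3: "K3 \<ge> 0" "\<And>x. -1 < x \<Longrightarrow> x < 1 \<Longrightarrow> \<bar>r x\<bar> \<le> K3 * ((1 - x) powr (-2) * (1 + x) powr 0)"
    using jacobi_log_bound[OF r(1) order.refl _ d(4)] by auto
  define K where "K = max K1 (max K2 K3)"
  have K: "K \<ge> 0" "K1 \<le> K" "K2 \<le> K" "K3 \<le> K" using K1 by (auto simp: K_def)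
  have upto: "y \<le> K * z" if "y \<le> k * (z * (1 + x) powr 0)" "k \<le> K" "z \<ge> 0" "-1 < x" for y z k x :: real
  proof -
    have "y \<le> k * z" using that by simp
    also have "\<dots> \<le> K * z" using that by (intro mult_right_mono) auto
    finally show ?thesis .
  qed
  have bp: "-1/2 < (0::real)" "-1/2 < b" using b by auto
  have parts: "((\<lambda>t. sin t * f' (cos t) * sin (real m * t)) has_integral (real m * cheb_int m f)) {0..pi}" if "m \<ge> 1" for m
    by (rule cheb_int_by_parts[OF f bp _ int that]) (rule f'(2))
  have "\<exists>C. \<forall>m\<ge>1. \<bar>integral {0..pi} (\<lambda>t. sin t * f' (cos t) * sin (real m * t))\<bar> \<le> C * real m powr (- 2 * 0)"
  proof (rule endpoint_oscillatory_bound[where p' = f'' and q' = "\<lambda>x. - r x" and K = K])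
    fix x :: real assume x: "-1 < x" "x < 1"
    show "(f' has_real_derivative f'' x) (at x)" by (rule f'(3)[OF x])
    show "((\<lambda>x. x * f' x - (1 - x\<^sup>2) * f'' x) has_real_derivative - r x) (at x)"
      using DERIV_minus[OF r(2)[OF x]] by simp
    show "\<bar>f' x\<bar> \<le> K * (1 - x) powr (0 - 1)" using upto[OF K1(2)[OF x] K(2)] x by simp
    have "\<bar>x * f' x - (1 - x\<^sup>2) * f'' x\<bar> = \<bar>(1 - x\<^sup>2) * f'' x - x * f' x\<bar>" by (rule abs_minus_commute)
    thus "\<bar>x * f' x - (1 - x\<^sup>2) * f'' x\<bar> \<le> K * (1 - x) powr (0 - 1)"
      using upto[OF K2(2)[OF x] K(3)] x by simp
    show "\<bar>- r x\<bar> \<le> K * (1 - x) powr (0 - 2)" using upto[OF K3(2)[OF x] K(4)] x by simp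
  next
    fix m :: nat assume "m \<ge> 1"
    thus "(\<lambda>t. sin t * f' (cos t) * sin (real m * t)) integrable_on {0..pi}" using parts by blast
  qed (use K in auto)
  then obtain C where C: "\<And>m. m \<ge> 1 \<Longrightarrow> \<bar>integral {0..pi} (\<lambda>t. sin t * f' (cos t) * sin (real m * t))\<bar> \<le> C"
    by auto
  have "\<bar>cheb_int m f\<bar> \<le> C * real m powr (-1)" if m: "m \<ge> 1" for m
  proof -
    have "real m * \<bar>cheb_int m f\<bar> \<le> C" using C[OF m] integral_unique[OF parts[OF m]] by (simp add: abs_mult)
    thus ?thesis using m by (simp add: powr_minus_divide field_simps)
  qed
  thus ?thesis by blast
qed

text \<open>
  This is the case \<open>\<sigma> = b\<close>, after the reflection of \<open>t\<close> to \<open>\<pi> - t\<close>, which moves the singular end from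
  \<open>-1\<close> to \<open>1\<close>. The assumption \<open>a \<ge> 3\<close> makes the logarithm at the other end harmless up to the
  third derivative.
\<close>

lemma cheb_int_algebraic_bound:
  assumes f: "jacobi_log a (real a) b f" and a: "a \<ge> 3" and b: "0 < b" "b < 1" and int: "cheb_integrable f"
  shows "\<exists>C. \<forall>m\<ge>1. \<bar>cheb_int m f\<bar> \<le> C * real m powr (- 2 * b - 1)"
proof -
  obtain f' f'' where f': "jacobi_log (a - 1) (real a - 1) (b - 1) f'"
    "\<And>x. -1 < x \<Longrightarrow> x < 1 \<Longrightarrow> (f has_real_derivative f' x) (at x)"
    "\<And>x. -1 < x \<Longrightarrow> x < 1 \<Longrightarrow> (f' has_real_derivative f'' x) (at x)"
    "jacobi_log (a - 1) (real a - 1) (b - 1) (\<lambda>x. (1 - x\<^sup>2) * f'' x - x * f' x)"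
    by (rule jacobi_log_cheb_op[OF f, of 0 "b - 1"]) auto
  define F where "F x = (1 - x\<^sup>2) * f'' x - x * f' x" for x
  have f'4: "jacobi_log (a - 1) (real a - 1) (b - 1) F" using f'(4) by (simp add: F_def[abs_def])
  obtain r where r: "jacobi_log (a - 1 - 1) (real a - 1 - 1) (b - 1 - 1) r"
    "\<And>x. -1 < x \<Longrightarrow> x < 1 \<Longrightarrow> (F has_real_derivative r x) (at x)"
    by (rule jacobi_log_deriv[OF f'4, of 0 "b - 1 - 1"]) (use a in auto)
  have a': "0 \<le> real a - 1" "0 < real (a - 1)" "0 \<le> real a - 1 - 1" "0 < real (a - 1 - 1)" using a by auto
  obtain K1 where K1: "K1 \<ge> 0" "\<And>x. -1 < x \<Longrightarrow> x < 1 \<Longrightarrow> \<bar>f' x\<bar> \<le> K1 * ((1 - x) powr 0 * (1 + x) powr (b - 1))"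
    using jacobi_log_bound[OF f'(1) a'(1,2) order.refl] by auto
  obtain K2 where K2: "K2 \<ge> 0" "\<And>x. -1 < x \<Longrightarrow> x < 1 \<Longrightarrow> \<bar>F x\<bar> \<le> K2 * ((1 - x) powr 0 * (1 + x) powr (b - 1))"
    using jacobi_log_bound[OF f'4 a'(1,2) order.refl] by auto
  obtain K3 where K3: "K3 \<ge> 0" "\<And>x. -1 < x \<Longrightarrow> x < 1 \<Longrightarrow> \<bar>r x\<bar> \<le> K3 * ((1 - x) powr 0 * (1 + x) powr (b - 1 - 1))"
    using jacobi_log_bound[OF r(1) a'(3,4) order.refl] by auto
  define K where "K = max K1 (max K2 K3)"
  have K: "K \<ge> 0" "K1 \<le> K" "K2 \<le> K" "K3 \<le> K" using K1 by (auto simp: K_def)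
  have upto: "y \<le> K * z" if "y \<le> k * ((1 - x) powr 0 * z)" "k \<le> K" "z \<ge> 0" "x < 1" for y z k x :: real
  proof -
    have "y \<le> k * z" using that by simp
    also have "\<dots> \<le> K * z" using that by (intro mult_right_mono) auto
    finally show ?thesis .
  qed
  have bp: "-1/2 < real a" "-1/2 < b" using b by auto
  have parts: "((\<lambda>t. sin t * f' (cos t) * sin (real m * t)) has_integral (real m * cheb_int m f)) {0..pi}" if "m \<ge> 1" for m
    by (rule cheb_int_by_parts[OF f bp _ int that]) (rule f'(2))
  have refl_int: "((\<lambda>t. sin t * f' (- cos t) * sin (real m * t)) has_integral (- ((-1) ^ m) * (real m * cheb_int m f))) {0..pi}"
    if m: "m \<ge> 1" for m
  proof -
    have "((\<lambda>t. sin (- t) * f' (cos (- t)) * sin (real m * (- t))) has_integral real m * cheb_int m f) {- pi..- 0}"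
      using has_integral_reflect_real[of "\<lambda>t. sin t * f' (cos t) * sin (real m * t)"] parts[OF m] by blast
    hence "((\<lambda>t. sin (- (t - pi)) * f' (cos (- (t - pi))) * sin (real m * (- (t - pi)))) has_integral real m * cheb_int m f) {0..pi}"
      using has_integral_shift_real_ivl[of "\<lambda>t. sin (- t) * f' (cos (- t)) * sin (real m * (- t))" "real m * cheb_int m f" "- pi" 0 "- pi"] by simp
    hence "((\<lambda>t. - ((-1) ^ m) * (sin (- (t - pi)) * f' (cos (- (t - pi))) * sin (real m * (- (t - pi))))) has_integral - ((-1) ^ m) * (real m * cheb_int m f)) {0..pi}"
      by (rule has_integral_mult_right)
    also have "(\<lambda>t. - ((-1) ^ m) * (sin (- (t - pi)) * f' (cos (- (t - pi))) * sin (real m * (- (t - pi))))) = (\<lambda>t. sin t * f' (- cos t) * sin (real m * t))"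
    proof
      fix t :: real
      have "sin (real m * (- (t - pi))) = sin (real m * pi - real m * t)" by (simp add: algebra_simps)
      also have "\<dots> = - ((-1) ^ m) * sin (real m * t)" by (simp add: sin_diff cos_npi)
      finally have 1: "sin (real m * (- (t - pi))) = - ((-1) ^ m) * sin (real m * t)" .
      have 2: "((-1) ^ m * (-1) ^ m :: real) = 1" by (simp flip: power_mult_distrib)
      have 3: "sin (- (t - pi)) = sin t" "cos (- (t - pi)) = - cos t" by (simp_all add: sin_diff cos_diff)
      show "- ((-1) ^ m) * (sin (- (t - pi)) * f' (cos (- (t - pi))) * sin (real m * (- (t - pi)))) = sin t * f' (- cos t) * sin (real m * t)"
        unfolding 1 3 using 2 by (simp add: mult_ac)
    qed
    finally show ?thesis .
  qed
  have "\<exists>C. \<forall>m\<ge>1. \<bar>integral {0..pi} (\<lambda>t. sin t * f' (- cos t) * sin (real m * t))\<bar> \<le> C * real m powr (- 2 * b)"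
  proof (rule endpoint_oscillatory_bound[where p = "\<lambda>x. f' (- x)" and p' = "\<lambda>x. - f'' (- x)" and q' = "\<lambda>x. - r (- x)" and K = K])
    fix x :: real assume x: "-1 < x" "x < 1"
    hence x': "-1 < - x" "- x < 1" by auto
    have m1: "((\<lambda>x. - x) has_real_derivative -1) (at x)" by (auto intro!: derivative_eq_intros)
    show "((\<lambda>x. f' (- x)) has_real_derivative - f'' (- x)) (at x)"
      using DERIV_chain2[OF f'(3)[OF x'] m1] by simp
    have Feq: "x * f' (- x) - (1 - x\<^sup>2) * - f'' (- x) = F (- x)" for x by (simp add: F_def)
    show "((\<lambda>x. x * f' (- x) - (1 - x\<^sup>2) * - f'' (- x)) has_real_derivative - r (- x)) (at x)"
      unfolding Feq using DERIV_chain2[OF r(2)[OF x'] m1] by simp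
    show "\<bar>f' (- x)\<bar> \<le> K * (1 - x) powr (b - 1)" using upto[OF K1(2)[OF x'] K(2)] x by simp
    show "\<bar>x * f' (- x) - (1 - x\<^sup>2) * - f'' (- x)\<bar> \<le> K * (1 - x) powr (b - 1)"
      unfolding Feq using upto[OF K2(2)[OF x'] K(3)] x by simp
    show "\<bar>- r (- x)\<bar> \<le> K * (1 - x) powr (b - 2)" using upto[OF K3(2)[OF x'] K(4)] x by simp
  next
    fix m :: nat assume "m \<ge> 1"
    thus "(\<lambda>t. sin t * f' (- cos t) * sin (real m * t)) integrable_on {0..pi}" using refl_int by blast
  qed (use K b in auto)
  then obtain C where C: "\<And>m. m \<ge> 1 \<Longrightarrow> \<bar>integral {0..pi} (\<lambda>t. sin t * f' (- cos t) * sin (real m * t))\<bar> \<le> C * real m powr (- 2 * b)"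
    by auto
  have "\<bar>cheb_int m f\<bar> \<le> C * real m powr (- 2 * b - 1)" if m: "m \<ge> 1" for m
  proof -
    have "real m * \<bar>cheb_int m f\<bar> \<le> C * real m powr (- 2 * b)"
      using C[OF m] integral_unique[OF refl_int[OF m]] by (simp add: abs_mult)
    moreover have "real m powr (- 2 * b - 1) = real m powr (- 2 * b) / real m" using m by (simp add: powr_diff)
    ultimately show ?thesis using m by (simp add: pos_le_divide_eq mult.commute)
  qed
  thus ?thesis by blast
qed

lemma cheb_int_rescale:
  assumes "\<bar>cheb_int m F\<bar> = real m ^ (2 * i) * \<bar>cheb_int m f\<bar>" "\<bar>cheb_int m F\<bar> \<le> C * real m powr r" "m \<ge> 1"
  shows "\<bar>cheb_int m f\<bar> \<le> C * real m powr (- 2 * real i + r)"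
proof -
  have "real m ^ (2 * i) = real m powr (2 * real i)"
    using powr_realpow[of "real m" "2 * i"] assms(3) by simp
  hence "real m powr (2 * real i) * \<bar>cheb_int m f\<bar> \<le> C * real m powr r" using assms by simp
  hence "real m powr (- 2 * real i) * (real m powr (2 * real i) * \<bar>cheb_int m f\<bar>) \<le> real m powr (- 2 * real i) * (C * real m powr r)"
    by (intro mult_left_mono) auto
  also have "real m powr (- 2 * real i) * (real m powr (2 * real i) * \<bar>cheb_int m f\<bar>) = real m powr (- 2 * real i + 2 * real i) * \<bar>cheb_int m f\<bar>"
    by (simp only: powr_add mult.assoc)
  also have "real m powr (- 2 * real i + 2 * real i) = 1" using assms(3) by simp
  also have "real m powr (- 2 * real i) * (C * real m powr r) = C * real m powr (- 2 * real i + r)"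
    by (simp only: powr_add mult_ac)
  finally show ?thesis by simp
qed

text \<open>
  Integrating by parts \<open>2 a\<close> times removes the algebraic factor and leaves a pure logarithm.
\<close>

lemma cheb_int_decay_smooth_left:
  assumes f: "jacobi_log a (real a) 0 f" and int: "cheb_integrable f"
  shows "\<exists>C. \<forall>m\<ge>1. \<bar>cheb_int m f\<bar> \<le> C * real m powr (- 2 * real a - 1)"
proof -
  obtain F where F: "jacobi_log 0 0 0 F" "cheb_integrable F" "\<forall>m\<ge>1. \<bar>cheb_int m F\<bar> = real m ^ (2 * a) * \<bar>cheb_int m f\<bar>"
    using cheb_int_iterate[of 0 a 0 f 0] f int by auto
  obtain C where C: "\<forall>m\<ge>1. \<bar>cheb_int m F\<bar> \<le> C * real m powr (-1)"
    using cheb_int_log_bound[OF F(1) _ F(2)] by auto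
  show ?thesis using cheb_int_rescale[of _ F a f C "-1"] F(3) C by (intro exI[of _ C]) auto
qed

lemma cheb_integrableI:
  assumes "continuous_on {-1..1} f" shows "cheb_integrable f"
  unfolding cheb_integrable_def
proof (intro allI impI integrable_continuous_real)
  fix m :: nat
  have "continuous_on {0..pi} (\<lambda>t. f (cos t))"
    by (rule continuous_on_compose2[OF assms]) (auto intro!: continuous_intros)
  thus "continuous_on {0..pi} (\<lambda>t. f (cos t) * cos (real m * t))" by (intro continuous_intros)
qed

text \<open>
  With \<open>u = (1 + x) / 2\<close> the constant \<open>1\<close> is the sum of \<open>1 - (1 - u\<^sup>N)\<^sup>N\<close>, a multiple of \<open>u\<^sup>N\<close>, and
  \<open>(1 - u\<^sup>N)\<^sup>N\<close>, a multiple of \<open>(1 - u)\<^sup>N\<close>. Multiplying \<open>f\<close> by these polynomials splits it into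
  \<open>f1\<close>, which is flat at \<open>-1\<close> and decays like the logarithmic singularity, and \<open>f2\<close>, which is flat at \<open>1\<close> and
  decays like the algebraic one.
\<close>

lemma cheb_int_decay_both_ends:
  assumes f: "jacobi_log a (real a) b f" and cont: "continuous_on {-1..1} f" and b: "b > 0" "b \<notin> \<int>"
  shows "\<exists>C. \<forall>m\<ge>1. \<bar>cheb_int m f\<bar> \<le> C * real m powr (- 2 * min (real a) b - 1)"
proof -
  define k where "k = nat \<lfloor>b\<rfloor>"
  have k: "real k < b" "b < real k + 1"
  proof -
    have e: "real k = of_int \<lfloor>b\<rfloor>" using b by (simp add: k_def)
    have "of_int \<lfloor>b\<rfloor> \<noteq> b" using b(2) by (metis Ints_of_int)
    thus "real k < b" using e of_int_floor_le[of b] by linarith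
    show "b < real k + 1" using e floor_less_iff[of b "\<lfloor>b\<rfloor> + 1"] by linarith
  qed
  \<comment> \<open>large enough that after \<open>a\<close> double integrations by parts \<open>f1\<close> keeps an exponent at least \<open>2\<close> at \<open>-1\<close>, and after \<open>k\<close> of them \<open>f2\<close> keeps one at least \<open>3\<close> at \<open>1\<close>\<close>
  define N where "N = a + k + 3"
  define u where "u x = (1 + x) / 2" for x :: real
  define P where "P x = (1 / 2) ^ N * (\<Sum>i<N. (1 - u x ^ N) ^ i)" for x
  define Q where "Q x = (1 / 2) ^ N * (\<Sum>i<N. u x ^ i) ^ N" for x
  have smooth: "C_inf_on {-1..1} P" "C_inf_on {-1..1} Q"
  proof -
    have "C_inf_on {-1..1} (\<lambda>x. 1 / 2 * (1 + x))" by (intro C_inf_on_intros)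
    hence u: "C_inf_on {-1..1} u" by (simp add: u_def[abs_def])
    show "C_inf_on {-1..1} P" "C_inf_on {-1..1} Q" unfolding P_def[abs_def] Q_def[abs_def] by (intro C_inf_on_intros u)+
  qed
  define f1 where "f1 x = (1 - x) ^ 0 * (1 + x) ^ N * P x * f x" for x
  define f2 where "f2 x = (1 - x) ^ N * (1 + x) ^ 0 * Q x * f x" for x
  have PQ: "(1 + x) ^ N * P x + (1 - x) ^ N * Q x = 1" for x
  proof -
    have "(1 + x) ^ N * P x = u x ^ N * (\<Sum>i<N. (1 - u x ^ N) ^ i)" by (simp add: P_def u_def power_divide)
    also have "\<dots> = 1 - (1 - u x ^ N) ^ N" using one_diff_power_eq[of "1 - u x ^ N" N] by simp
    finally have 1: "(1 + x) ^ N * P x = 1 - (1 - u x ^ N) ^ N" .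
    have "(1 - x) ^ N * Q x = ((1 - u x) * (\<Sum>i<N. u x ^ i)) ^ N"
      by (simp add: Q_def u_def power_mult_distrib[symmetric] field_simps)
    also have "\<dots> = (1 - u x ^ N) ^ N" by (simp only: one_diff_power_eq)
    finally show ?thesis using 1 by simp
  qed
  have sum: "f x = f1 x + f2 x" for x
  proof -
    have "f x = ((1 + x) ^ N * P x + (1 - x) ^ N * Q x) * f x" by (simp add: PQ)
    thus ?thesis by (simp add: f1_def f2_def algebra_simps)
  qed
  have j1: "jacobi_log (0 + a) (real (0 + a)) (b + real N) f1"
    using jacobi_log_times_smooth[OF f smooth(1), of 0 N] by (simp add: f1_def[abs_def])
  have j2: "jacobi_log ((a + N - k) + k) (real ((a + N - k) + k)) b f2"
  proof -
    have "(a + N - k) + k = a + N" by (simp add: N_def)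
    thus ?thesis using jacobi_log_times_smooth[OF f smooth(2), of N 0] by (simp add: f2_def[abs_def])
  qed
  have c1: "cheb_integrable f1" and c2: "cheb_integrable f2"
    unfolding f1_def[abs_def] f2_def[abs_def]
    by (intro cheb_integrableI continuous_intros cont C_inf_on_continuous smooth)+
  have add: "cheb_int m f = cheb_int m f1 + cheb_int m f2" if "m \<ge> 1" for m
  proof -
    have "integral {0..pi} (\<lambda>t. f1 (cos t) * cos (real m * t) + f2 (cos t) * cos (real m * t)) = cheb_int m f1 + cheb_int m f2"
      unfolding cheb_int_def using c1 c2 that unfolding cheb_integrable_def by (intro integral_add) auto
    thus ?thesis by (simp add: cheb_int_def sum distrib_right)
  qed
  have "\<exists>C. \<forall>m\<ge>1. \<bar>cheb_int m f1\<bar> \<le> C * real m powr (- 2 * real a - 1)"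
  proof -
    obtain F where F: "jacobi_log 0 0 (b + real N - real a) F" "cheb_integrable F" "\<forall>m\<ge>1. \<bar>cheb_int m F\<bar> = real m ^ (2 * a) * \<bar>cheb_int m f1\<bar>"
      using cheb_int_iterate[OF j1 c1, of "b + real N - real a"] b by (auto simp: N_def)
    have "b + real N - real a \<ge> 2" using b by (simp add: N_def)
    then obtain C where C: "\<forall>m\<ge>1. \<bar>cheb_int m F\<bar> \<le> C * real m powr (-1)"
      using cheb_int_log_bound[OF F(1) _ F(2)] by auto
    show ?thesis using cheb_int_rescale[of _ F a f1 C "-1"] F(3) C by (intro exI[of _ C]) auto
  qed
  then obtain C1 where C1: "\<And>m. m \<ge> 1 \<Longrightarrow> \<bar>cheb_int m f1\<bar> \<le> C1 * real m powr (- 2 * real a - 1)" by blast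
  have "\<exists>C. \<forall>m\<ge>1. \<bar>cheb_int m f2\<bar> \<le> C * real m powr (- 2 * b - 1)"
  proof -
    obtain F where F: "jacobi_log (a + N - k) (real (a + N - k)) (b - real k) F" "cheb_integrable F" "\<forall>m\<ge>1. \<bar>cheb_int m F\<bar> = real m ^ (2 * k) * \<bar>cheb_int m f2\<bar>"
      using cheb_int_iterate[OF j2 c2, of "b - real k"] b k by auto
    obtain C where C: "\<forall>m\<ge>1. \<bar>cheb_int m F\<bar> \<le> C * real m powr (- 2 * (b - real k) - 1)"
      using cheb_int_algebraic_bound[OF F(1) _ _ _ F(2)] k by (auto simp: N_def)
    have e: "- 2 * real k + (- 2 * (b - real k) - 1) = - 2 * b - 1" by simp
    show ?thesis using cheb_int_rescale[of _ F k f2 C "- 2 * (b - real k) - 1", unfolded e] F(3) C by (intro exI[of _ C]) auto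
  qed
  then obtain C2 where C2: "\<And>m. m \<ge> 1 \<Longrightarrow> \<bar>cheb_int m f2\<bar> \<le> C2 * real m powr (- 2 * b - 1)" by blast
  show ?thesis
  proof (intro exI[of _ "\<bar>C1\<bar> + \<bar>C2\<bar>"] allI impI)
    fix m :: nat assume m: "m \<ge> 1"
    let ?r = "real m powr (- 2 * min (real a) b - 1)"
    have p: "real m powr (- 2 * real a - 1) \<le> ?r" "real m powr (- 2 * b - 1) \<le> ?r"
      using m by (auto intro!: powr_mono)
    have "\<bar>cheb_int m f\<bar> \<le> \<bar>cheb_int m f1\<bar> + \<bar>cheb_int m f2\<bar>" using add[OF m] by simp
    also have "\<dots> \<le> C1 * real m powr (- 2 * real a - 1) + C2 * real m powr (- 2 * b - 1)"
      by (intro add_mono C1 C2 m)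
    also have "\<dots> \<le> \<bar>C1\<bar> * ?r + \<bar>C2\<bar> * ?r"
      using p by (intro add_mono mult_mono) auto
    finally show "\<bar>cheb_int m f\<bar> \<le> (\<bar>C1\<bar> + \<bar>C2\<bar>) * ?r" by (simp add: distrib_right)
  qed
qed

section \<open>Clenshaw-Curtis quadrature of Chebyshev polynomials\<close>

text \<open>
  This is the Chebyshev polynomial \<open>T\<^sub>m\<close> on \<open>[-1, 1]\<close>, in trigonometric form.
\<close>

definition cheb_poly :: "nat \<Rightarrow> real \<Rightarrow> real" where
  "cheb_poly m x = cos (real m * arccos x)"

definition cheb_poly_integral :: "nat \<Rightarrow> real" where
  "cheb_poly_integral m = (if even m then 2 / (1 - (real m)\<^sup>2) else 0)"

lemma continuous_on_cheb_poly [continuous_intros]: "continuous_on {-1..1} (cheb_poly m)"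
  unfolding cheb_poly_def[abs_def] by (intro continuous_intros) auto

lemma abs_cheb_poly_le: "\<bar>cheb_poly m x\<bar> \<le> 1"
  by (simp add: cheb_poly_def)

lemma cheb_poly_cos: "0 \<le> t \<Longrightarrow> t \<le> pi \<Longrightarrow> cheb_poly m (cos t) = cos (real m * t)"
  by (simp add: cheb_poly_def arccos_cos)

lemma has_integral_cheb_poly: "(cheb_poly m has_integral cheb_poly_integral m) {-1..1}"
proof -
  \<comment> \<open>for \<open>m = 1\<close> the second term is a division by \<open>0\<close>, hence \<open>0\<close>, which is the correct antiderivative\<close>
  define A where "A y = (cos ((real m + 1) * y) / (real m + 1) - cos ((real m - 1) * y) / (real m - 1)) / 2" for y
  have dA: "(A has_real_derivative - (cos (real m * y) * sin y)) (at y)" for y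
  proof -
    have D: "((\<lambda>y. cos (c * y) / c) has_real_derivative - sin (c * y)) (at y)" for c :: real
    proof (cases "c = 0")
      case False
      have "((\<lambda>y. cos (c * y)) has_real_derivative - sin (c * y) * c) (at y)"
        by (auto intro!: derivative_eq_intros)
      from DERIV_cdivide[OF this, of c] show ?thesis using False by simp
    qed simp
    have "(A has_real_derivative (- sin ((real m + 1) * y) - (- sin ((real m - 1) * y))) / 2) (at y)"
      unfolding A_def[abs_def] by (rule DERIV_cdivide[OF DERIV_diff[OF D D]])
    also have "(- sin ((real m + 1) * y) - (- sin ((real m - 1) * y))) / 2 = - (cos (real m * y) * sin y)"
    proof -
      have e: "(real m + 1) * y = real m * y + y" "(real m - 1) * y = real m * y - y" by (simp_all add: algebra_simps)
      show ?thesis unfolding e sin_add sin_diff by simp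
    qed
    finally show ?thesis .
  qed
  have "((\<lambda>x. cheb_poly m x) has_integral (A (arccos 1) - A (arccos (-1)))) {-1..1}"
  proof (rule fundamental_theorem_of_calculus_interior)
    have "continuous_on UNIV A" using dA by (meson DERIV_isCont continuous_at_imp_continuous_on)
    thus "continuous_on {-1..1} (\<lambda>x. A (arccos x))"
      by (rule continuous_on_compose2) (auto intro!: continuous_intros)
    fix x :: real assume x: "x \<in> {-1<..<1}"
    have s: "sin (arccos x) \<noteq> 0" using sin_arccos_nonzero[of x] x by auto
    have "((\<lambda>x. A (arccos x)) has_real_derivative - (cos (real m * arccos x) * sin (arccos x)) * inverse (- sqrt (1 - x\<^sup>2))) (at x)"
      using x by (intro DERIV_chain2[OF dA] DERIV_arccos) auto
    also have "- (cos (real m * arccos x) * sin (arccos x)) * inverse (- sqrt (1 - x\<^sup>2)) = cheb_poly m x"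
      using s x by (simp add: sin_arccos cheb_poly_def)
    finally show "((\<lambda>x. A (arccos x)) has_vector_derivative cheb_poly m x) (at x)"
      by (simp add: has_real_derivative_iff_has_vector_derivative)
  qed auto
  also have "A (arccos 1) - A (arccos (-1)) = cheb_poly_integral m"
  proof -
    have c: "cos ((real m + 1) * pi) = - ((-1) ^ m)" "cos ((real m - 1) * pi) = - ((-1) ^ m)"
      by (simp_all add: distrib_right left_diff_distrib cos_add cos_diff cos_npi)
    have "A (arccos 1) - A (arccos (-1)) = (1 + (-1) ^ m) / 2 * (1 / (real m + 1) - 1 / (real m - 1))"
      unfolding A_def arccos_1 arccos_minus_1 c by (simp add: algebra_simps add_divide_distrib diff_divide_distrib)
    also have "\<dots> = cheb_poly_integral m"
    proof (cases "even m")
      case True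
      hence "real m \<noteq> 1" by auto
      moreover have "(real m)\<^sup>2 \<noteq> 1" using True by (auto simp: power2_eq_1_iff)
      ultimately have "1 / (real m + 1) - 1 / (real m - 1) = 2 / (1 - (real m)\<^sup>2)"
        by (simp add: field_simps power2_eq_square)
      thus ?thesis using True by (simp add: cheb_poly_integral_def)
    qed (simp add: cheb_poly_integral_def)
    finally show ?thesis .
  qed
  finally show ?thesis .
qed

lemma abs_cheb_poly_integral_le:
  assumes "m \<ge> 1" shows "\<bar>cheb_poly_integral m\<bar> \<le> 4 / (real m)\<^sup>2"
proof (cases "even m")
  case True
  hence "real m \<ge> 2" using assms by (cases "m = 1") auto
  hence "(real m)\<^sup>2 \<ge> 2\<^sup>2" by (intro power_mono) auto
  hence m: "(real m)\<^sup>2 \<ge> 4" by simp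
  have "\<bar>cheb_poly_integral m\<bar> = 2 / ((real m)\<^sup>2 - 1)"
    using True m by (simp add: cheb_poly_integral_def abs_if field_simps)
  also have "\<dots> \<le> 4 / (real m)\<^sup>2" using m assms by (simp add: field_simps)
  finally show ?thesis .
qed (simp add: cheb_poly_integral_def)

lemma cc_delta_sum:
  assumes "n \<ge> 1"
  shows "(\<Sum>j = 0..n. cc_delta n j * h j) = (\<Sum>j<n. (h j + h (Suc j)) / 2)"
proof -
  have "(\<Sum>j = 0..n. cc_delta n j * h j) = (\<Sum>j = 0..n. h j - (if j = 0 then h j / 2 else 0) - (if j = n then h j / 2 else 0))"
    using assms by (intro sum.cong) (auto simp: cc_delta_def)
  also have "\<dots> = (\<Sum>j = 0..n. h j) - h 0 / 2 - h n / 2"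
    by (simp add: sum_subtractf)
  finally have 1: "(\<Sum>j = 0..n. cc_delta n j * h j) = (\<Sum>j = 0..n. h j) - h 0 / 2 - h n / 2" .
  have 2: "(\<Sum>j<n. (h j + h (Suc j)) / 2) = (\<Sum>j = 0..n. h j) - h 0 / 2 - h n / 2"
    by (induction n) (auto simp: atLeast0AtMost field_simps)
  show ?thesis using 1 2 by simp
qed

text \<open>
  Discrete orthogonality of the cosines. Multiplying the trapezoidal sum of \<open>cos(j x)\<close> by \<open>2 sin(x/2)\<close> makes it
  telescope to \<open>cos(x/2) sin(n x)\<close>, and \<open>n x\<close> is a multiple of \<open>\<pi>\<close>. The factor \<open>sin(x/2)\<close> is zero only
  when \<open>2 n\<close> divides \<open>p\<close>, in which case all summands are \<open>1\<close>.
\<close>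

lemma trapezoidal_cos_sum:
  fixes p :: int
  assumes n: "n \<ge> 1"
  shows "(\<Sum>j = 0..n. cc_delta n j * cos (real j * (of_int p * pi / real n))) = (if int (2 * n) dvd p then real n else 0)"
proof -
  define x where "x = of_int p * pi / real n"
  have half: "sin (x / 2) = 0 \<longleftrightarrow> int (2 * n) dvd p"
  proof -
    have "sin (x / 2) = 0 \<longleftrightarrow> (\<exists>i::int. x / 2 = of_int i * pi)" by (simp add: sin_zero_iff_int2)
    also have "\<dots> \<longleftrightarrow> (\<exists>i::int. p = int (2 * n) * i)"
    proof (intro ex_cong1)
      fix i :: int
      have "x / 2 = of_int i * pi \<longleftrightarrow> (of_int p :: real) = of_int (int (2 * n) * i)"
        using n by (simp add: x_def field_simps)
      thus "x / 2 = of_int i * pi \<longleftrightarrow> p = int (2 * n) * i" by (simp only: of_int_eq_iff)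
    qed
    finally show ?thesis by (simp only: dvd_def)
  qed
  have nx: "real n * x = of_int p * pi" using n by (simp add: x_def)
  show ?thesis
  proof (cases "int (2 * n) dvd p")
    case True
    then obtain i where i: "p = int (2 * n) * i" by (auto simp: dvd_def)
    have "cos (real j * x) = 1" for j
    proof -
      have "real j * x = 2 * of_int (int j * i) * pi" using n by (simp add: x_def i)
      thus ?thesis by (metis cos_int_2pin mult.commute mult.left_commute)
    qed
    hence "(\<Sum>j = 0..n. cc_delta n j * cos (real j * x)) = (\<Sum>j<n. (1 + 1) / 2)"
      by (subst cc_delta_sum[OF n]) (simp del: of_nat_Suc)
    thus ?thesis using True by (simp add: x_def)
  next
    case False
    have "2 * sin (x / 2) * (\<Sum>j<n. (cos (real j * x) + cos (real (Suc j) * x)) / 2)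
        = (\<Sum>j<n. cos (x / 2) * (sin (real (Suc j) * x) - sin (real j * x)))"
      unfolding sum_distrib_left
    proof (intro sum.cong refl)
      fix j
      define y where "y = real j * x + x / 2"
      have y: "real j * x = y - x / 2" "real (Suc j) * x = y + x / 2" by (simp_all add: y_def algebra_simps)
      show "2 * sin (x / 2) * ((cos (real j * x) + cos (real (Suc j) * x)) / 2) = cos (x / 2) * (sin (real (Suc j) * x) - sin (real j * x))"
        unfolding y sin_add sin_diff cos_add cos_diff by (simp add: algebra_simps)
    qed
    also have "\<dots> = cos (x / 2) * (\<Sum>j<n. sin (real (Suc j) * x) - sin (real j * x))" by (rule sum_distrib_left[symmetric])
    also have "(\<Sum>j<n. sin (real (Suc j) * x) - sin (real j * x)) = sin (real n * x)"
      using sum_lessThan_telescope[of "\<lambda>j. sin (real j * x)" n] by simp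
    also have "sin (real n * x) = 0" unfolding nx by (metis mult.commute sin_npi_int)
    finally have "(\<Sum>j<n. (cos (real j * x) + cos (real (Suc j) * x)) / 2) = 0" using half False by simp
    thus ?thesis using False unfolding x_def[symmetric] by (subst cc_delta_sum[OF n]) simp
  qed
qed

lemma cc_rule_cong:
  assumes "\<And>j. j \<le> n \<Longrightarrow> f (cc_node n j) = g (cc_node n j)" shows "cc_rule n f = cc_rule n g"
  unfolding cc_rule_def using assms by (intro sum.cong) auto

lemma cheb_poly_cc_node:
  assumes "j \<le> n" "n \<ge> 1" shows "cheb_poly m (cc_node n j) = cos (real m * (real j * pi / real n))"
  unfolding cc_node_def using assms by (intro cheb_poly_cos) (auto simp: field_simps)

text \<open>
  Exactness. By discrete orthogonality only the summand with \<open>2 k = r\<close> of the weights survives. For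
  \<open>r = 0\<close> and \<open>r = n\<close> it is counted twice, which the factor \<open>1/2\<close> in the weights compensates.
\<close>

lemma cc_rule_cheb_poly:
  assumes n: "n \<ge> 1" and r: "r \<le> n"
  shows "cc_rule n (cheb_poly r) = cheb_poly_integral r"
proof -
  define D where "D p = (if int (2 * n) dvd p then real n else 0)" for p :: int
  have "cc_rule n (cheb_poly r) = (\<Sum>j = 0..n. \<Sum>k = 0..n div 2. 4 / real n * (cc_delta n (2 * k) / (1 - 4 * (real k)\<^sup>2)) *
        (cc_delta n j * (cos (2 * real j * real k * pi / real n) * cos (real r * (real j * pi / real n)))))"
    unfolding cc_rule_def cc_weight_def
  proof (intro sum.cong refl)
    fix j assume "j \<in> {0..n}"
    hence cn: "cheb_poly r (cc_node n j) = cos (real r * (real j * pi / real n))" by (intro cheb_poly_cc_node n) auto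
    show "4 * cc_delta n j / real n * (\<Sum>k = 0..n div 2. cc_delta n (2 * k) / (1 - 4 * (real k)\<^sup>2) * cos (2 * real j * real k * pi / real n)) * cheb_poly r (cc_node n j)
      = (\<Sum>k = 0..n div 2. 4 / real n * (cc_delta n (2 * k) / (1 - 4 * (real k)\<^sup>2)) *
        (cc_delta n j * (cos (2 * real j * real k * pi / real n) * cos (real r * (real j * pi / real n)))))"
      unfolding cn sum_distrib_left sum_distrib_right by (intro sum.cong refl) simp
  qed
  also have "\<dots> = (\<Sum>k = 0..n div 2. 4 / real n * (cc_delta n (2 * k) / (1 - 4 * (real k)\<^sup>2)) *
        (\<Sum>j = 0..n. cc_delta n j * (cos (2 * real j * real k * pi / real n) * cos (real r * (real j * pi / real n)))))"
    by (subst sum.swap) (simp only: sum_distrib_left)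
  also have "\<dots> = (\<Sum>k = 0..n div 2. if r = 2 * k then cheb_poly_integral r else 0)"
  proof (intro sum.cong refl)
    fix k assume "k \<in> {0..n div 2}"
    hence k: "2 * k \<le> n" by auto
    have "(\<Sum>j = 0..n. cc_delta n j * (cos (2 * real j * real k * pi / real n) * cos (real r * (real j * pi / real n))))
        = (\<Sum>j = 0..n. (cc_delta n j * cos (real j * (of_int (int (2 * k) - int r) * pi / real n)) + cc_delta n j * cos (real j * (of_int (int (2 * k) + int r) * pi / real n))) / 2)"
    proof (intro sum.cong refl)
      fix j
      define u v where "u = 2 * real j * real k * pi / real n" and "v = real r * (real j * pi / real n)"
      have e: "real j * (of_int (int (2 * k) - int r) * pi / real n) = u - v"
           "real j * (of_int (int (2 * k) + int r) * pi / real n) = u + v"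
        by (simp_all add: u_def v_def algebra_simps add_divide_distrib diff_divide_distrib)
      show "cc_delta n j * (cos (2 * real j * real k * pi / real n) * cos (real r * (real j * pi / real n)))
        = (cc_delta n j * cos (real j * (of_int (int (2 * k) - int r) * pi / real n)) + cc_delta n j * cos (real j * (of_int (int (2 * k) + int r) * pi / real n))) / 2"
        unfolding e u_def[symmetric] v_def[symmetric] cos_add cos_diff by (simp add: algebra_simps)
    qed
    also have "\<dots> = (D (int (2 * k) - int r) + D (int (2 * k) + int r)) / 2"
      unfolding sum_divide_distrib[symmetric] sum.distrib trapezoidal_cos_sum[OF n] D_def by simp
    finally have S: "(\<Sum>j = 0..n. cc_delta n j * (cos (2 * real j * real k * pi / real n) * cos (real r * (real j * pi / real n))))
       = (D (int (2 * k) - int r) + D (int (2 * k) + int r)) / 2" .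
    have D1: "D (int (2 * k) - int r) = (if r = 2 * k then real n else 0)"
    proof (cases "r = 2 * k")
      case False
      have "\<bar>int (2 * k) - int r\<bar> < int (2 * n)" "int (2 * k) - int r \<noteq> 0" using False k r n by auto
      hence "\<not> int (2 * n) dvd (int (2 * k) - int r)" using dvd_imp_le_int[of "int (2 * k) - int r" "int (2 * n)"] by linarith
      thus ?thesis using False by (simp add: D_def)
    qed (simp add: D_def)
    have D2: "D (int (2 * k) + int r) = (if r = 2 * k \<and> (r = 0 \<or> r = n) then real n else 0)"
    proof (cases "r = 2 * k \<and> (r = 0 \<or> r = n)")
      case True
      thus ?thesis by (auto simp: D_def)
    next
      case False
      have "0 < 2 * k + r" "2 * k + r < 2 * n" using False k r n by auto
      hence "\<not> 2 * n dvd 2 * k + r" by (auto dest: dvd_imp_le)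
      hence "\<not> int (2 * n) dvd int (2 * k + r)" by (simp only: int_dvd_int_iff not_False_eq_True)
      thus ?thesis using False by (auto simp: D_def)
    qed
    show "4 / real n * (cc_delta n (2 * k) / (1 - 4 * (real k)\<^sup>2)) *
        (\<Sum>j = 0..n. cc_delta n j * (cos (2 * real j * real k * pi / real n) * cos (real r * (real j * pi / real n))))
       = (if r = 2 * k then cheb_poly_integral r else 0)"
      unfolding S D1 D2 using n by (auto simp: cc_delta_def cheb_poly_integral_def power2_eq_square)
  qed
  also have "\<dots> = cheb_poly_integral r"
  proof (cases "even r")
    case True
    then obtain k where k: "r = 2 * k" by (auto elim: evenE)
    hence "(\<Sum>i = 0..n div 2. if r = 2 * i then cheb_poly_integral r else 0) = (\<Sum>i = 0..n div 2. if i = k then cheb_poly_integral r else 0)"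
      by (intro sum.cong) auto
    also have "\<dots> = cheb_poly_integral r" using k r by simp
    finally show ?thesis .
  next
    case False
    hence "(\<Sum>i = 0..n div 2. if r = 2 * i then cheb_poly_integral r else 0) = 0" by (intro sum.neutral) auto
    thus ?thesis using False by (simp add: cheb_poly_integral_def)
  qed
  finally show ?thesis .
qed

lemma cc_rule_cheb_poly_alias:
  assumes n: "n \<ge> 1" and r: "r \<le> n"
  shows "cc_rule n (cheb_poly (2 * n * p + r)) = cheb_poly_integral r"
    and "r \<le> 2 * n * p \<Longrightarrow> cc_rule n (cheb_poly (2 * n * p - r)) = cheb_poly_integral r"
proof -
  have e: "real (2 * n * p) * (real j * pi / real n) = 2 * pi * real (p * j)" for j
    using n by (simp add: field_simps)
  have c: "cos (2 * pi * real i) = 1" "sin (2 * pi * real i) = 0" for i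
    using cos_int_2pin[of "int i"] sin_int_2pin[of "int i"] by simp_all
  have "cc_rule n (cheb_poly (2 * n * p + r)) = cc_rule n (cheb_poly r)"
  proof (rule cc_rule_cong)
    fix j assume j: "j \<le> n"
    show "cheb_poly (2 * n * p + r) (cc_node n j) = cheb_poly r (cc_node n j)"
      unfolding cheb_poly_cc_node[OF j n] of_nat_add distrib_right e cos_add c by simp
  qed
  thus "cc_rule n (cheb_poly (2 * n * p + r)) = cheb_poly_integral r" using cc_rule_cheb_poly[OF n r] by simp
  assume le: "r \<le> 2 * n * p"
  have "cc_rule n (cheb_poly (2 * n * p - r)) = cc_rule n (cheb_poly r)"
  proof (rule cc_rule_cong)
    fix j assume j: "j \<le> n"
    show "cheb_poly (2 * n * p - r) (cc_node n j) = cheb_poly r (cc_node n j)"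
      unfolding cheb_poly_cc_node[OF j n] of_nat_diff[OF le] left_diff_distrib e cos_diff c by simp
  qed
  thus "cc_rule n (cheb_poly (2 * n * p - r)) = cheb_poly_integral r" using cc_rule_cheb_poly[OF n r] by simp
qed

section \<open>Chebyshev series\<close>

lemma integral_cos_cos:
  "((\<lambda>t. cos (real i * t) * cos (real m * t)) has_integral (if i = m then if m = 0 then pi else pi / 2 else 0)) {0..pi}"
proof -
  have I: "((\<lambda>t. cos (of_int k * t)) has_integral (if k = 0 then pi else 0)) {0..pi}" for k :: int
  proof (cases "k = 0")
    case True
    thus ?thesis using has_integral_const_real[of "1::real" 0 pi] by simp
  next
    case False
    have "((\<lambda>t. cos (of_int k * t)) has_integral (sin (of_int k * pi) / of_int k - sin (of_int k * 0) / of_int k)) {0..pi}"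
    proof (rule fundamental_theorem_of_calculus)
      fix x :: real
      have "((\<lambda>t. sin (of_int k * t) / of_int k) has_real_derivative cos (of_int k * x)) (at x)"
        using False by (auto intro!: derivative_eq_intros)
      thus "((\<lambda>t. sin (of_int k * t) / of_int k) has_vector_derivative cos (of_int k * x)) (at x within {0..pi})"
        by (simp add: has_field_derivative_at_within has_real_derivative_iff_has_vector_derivative[symmetric])
    qed simp
    moreover have "sin (of_int k * pi) = 0" by (metis mult.commute sin_npi_int)
    ultimately show ?thesis using False by simp
  qed
  have "((\<lambda>t. (cos (of_int (int i - int m) * t) + cos (of_int (int i + int m) * t)) / 2) has_integral
      ((if int i - int m = 0 then pi else 0) + (if int i + int m = 0 then pi else 0)) / 2) {0..pi}"
    by (intro has_integral_divide has_integral_add I)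
  also have "(\<lambda>t. (cos (of_int (int i - int m) * t) + cos (of_int (int i + int m) * t)) / 2) = (\<lambda>t. cos (real i * t) * cos (real m * t))"
    by (simp add: distrib_right left_diff_distrib cos_add cos_diff)
  finally show ?thesis by (rule back_subst[where P = "\<lambda>y. (_ has_integral y) _"]) auto
qed

lemma continuous_on_comp_cos: "continuous_on {-1..1} f \<Longrightarrow> continuous_on {0..pi} (\<lambda>t. f (cos t))"
  by (rule continuous_on_compose2[where s = "{0..pi}" and f = cos]) (auto intro!: continuous_intros)

text \<open>
  All moments of \<open>d(cos t)\<close> against powers of \<open>cos t\<close> vanish, by the product formula for cosines. So \<open>d\<close> is orthogonal
  to polynomials that approximate it uniformly, hence to itself.
\<close>

lemma cheb_int_eq_0_imp_eq_0:
  assumes d: "continuous_on {-1..1} d" and z: "\<And>m. cheb_int m d = 0" and x: "x \<in> {-1..1}"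
  shows "d x = 0"
proof -
  have cd: "continuous_on {0..pi} (\<lambda>t. d (cos t))" by (rule continuous_on_comp_cos[OF d])
  have pow: "((\<lambda>t. d (cos t) * cos t ^ k * cos (real m * t)) has_integral 0) {0..pi}" for k m
  proof (induction k arbitrary: m)
    case 0
    have "(\<lambda>t. d (cos t) * cos (real m * t)) integrable_on {0..pi}"
      by (intro integrable_continuous_real continuous_intros cd)
    thus ?case using z[of m] by (simp add: cheb_int_def has_integral_integral)
  next
    case (Suc k)
    have c: "cos t * cos (real m * t) = (cos (real (m + 1) * t) + cos (real (if m = 0 then 1 else m - 1) * t)) / 2" for t
    proof (cases "m = 0")
      case False
      hence "real (m - 1) = real m - 1" by (simp add: of_nat_diff)
      thus ?thesis using False by (simp add: distrib_right left_diff_distrib cos_add cos_diff)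
    qed simp
    have "((\<lambda>t. (d (cos t) * cos t ^ k * cos (real (m + 1) * t) + d (cos t) * cos t ^ k * cos (real (if m = 0 then 1 else m - 1) * t)) / 2)
        has_integral ((0 + 0) / 2)) {0..pi}"
      by (intro has_integral_divide has_integral_add Suc)
    also have "(\<lambda>t. (d (cos t) * cos t ^ k * cos (real (m + 1) * t) + d (cos t) * cos t ^ k * cos (real (if m = 0 then 1 else m - 1) * t)) / 2)
        = (\<lambda>t. d (cos t) * cos t ^ k * (cos t * cos (real m * t)))"
      unfolding c by (simp add: algebra_simps)
    finally show ?case by (simp add: mult_ac)
  qed
  define B where "B = integral {0..pi} (\<lambda>t. \<bar>d (cos t)\<bar>)"
  have Bi: "(\<lambda>t. \<bar>d (cos t)\<bar>) integrable_on {0..pi}"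
    by (intro integrable_continuous_real continuous_intros cd)
  have small: "integral {0..pi} (\<lambda>t. (d (cos t))\<^sup>2) \<le> e * B" if e: "e > 0" for e
  proof -
    obtain g where g: "real_polynomial_function g" "\<And>x. x \<in> {-1..1} \<Longrightarrow> \<bar>d x - g x\<bar> < e"
      using Stone_Weierstrass_real_polynomial_function[OF compact_Icc d e] by blast
    obtain a N where gs: "g = (\<lambda>x. \<Sum>i\<le>N. a i * x ^ i)" using g(1) real_polynomial_function_iff_sum by blast
    have "((\<lambda>t. \<Sum>i\<le>N. a i * (d (cos t) * cos t ^ i * cos (real 0 * t))) has_integral (\<Sum>i\<le>N. a i * 0)) {0..pi}"
      by (intro has_integral_sum has_integral_mult_right pow) auto
    hence dg: "((\<lambda>t. d (cos t) * g (cos t)) has_integral 0) {0..pi}"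
      by (simp add: gs sum_distrib_left mult_ac)
    have dd: "(\<lambda>t. (d (cos t))\<^sup>2) integrable_on {0..pi}"
      by (intro integrable_continuous_real continuous_intros cd)
    have "((\<lambda>t. (d (cos t))\<^sup>2 - d (cos t) * g (cos t)) has_integral (integral {0..pi} (\<lambda>t. (d (cos t))\<^sup>2) - 0)) {0..pi}"
      by (intro has_integral_diff integrable_integral dd dg)
    moreover have "((\<lambda>t. e * \<bar>d (cos t)\<bar>) has_integral e * B) {0..pi}"
      unfolding B_def by (intro has_integral_mult_right integrable_integral Bi)
    ultimately have "integral {0..pi} (\<lambda>t. (d (cos t))\<^sup>2) - 0 \<le> e * B"
    proof (rule has_integral_le)
      fix t :: real
      have "(d (cos t))\<^sup>2 - d (cos t) * g (cos t) = d (cos t) * (d (cos t) - g (cos t))" by (simp add: power2_eq_square algebra_simps)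
      also have "\<dots> \<le> \<bar>d (cos t)\<bar> * \<bar>d (cos t) - g (cos t)\<bar>" by (metis abs_ge_self abs_mult)
      also have "\<dots> \<le> \<bar>d (cos t)\<bar> * e" using g(2)[of "cos t"] by (intro mult_left_mono) auto
      finally show "(d (cos t))\<^sup>2 - d (cos t) * g (cos t) \<le> e * \<bar>d (cos t)\<bar>" by (simp add: mult.commute)
    qed
    thus ?thesis by simp
  qed
  have B0: "B \<ge> 0" unfolding B_def by (intro integral_nonneg Bi) auto
  have "integral {0..pi} (\<lambda>t. (d (cos t))\<^sup>2) \<le> 0"
  proof (rule field_le_epsilon)
    fix e :: real assume e: "e > 0"
    have "integral {0..pi} (\<lambda>t. (d (cos t))\<^sup>2) \<le> e / (B + 1) * B" using e B0 by (intro small) auto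
    also have "\<dots> \<le> e" using e B0 by (simp add: field_simps)
    finally show "integral {0..pi} (\<lambda>t. (d (cos t))\<^sup>2) \<le> 0 + e" by simp
  qed
  moreover have "integral {0..pi} (\<lambda>t. (d (cos t))\<^sup>2) \<ge> 0"
    by (intro integral_nonneg integrable_continuous_real continuous_intros cd) auto
  ultimately have "integral {0..pi} (\<lambda>t. (d (cos t))\<^sup>2) = 0" by simp
  hence "\<forall>t\<in>{0..pi}. (d (cos t))\<^sup>2 = 0"
    by (subst (asm) integral_eq_0_iff) (auto intro!: continuous_intros cd)
  moreover have "arccos x \<in> {0..pi}" using x by (auto intro: arccos_lbound arccos_ubound)
  ultimately have "(d (cos (arccos x)))\<^sup>2 = 0" by blast
  thus ?thesis using x by (simp add: cos_arccos)
qed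

definition cheb_coeff :: "(real \<Rightarrow> real) \<Rightarrow> nat \<Rightarrow> real" where
  "cheb_coeff f m = (if m = 0 then 1 else 2) / pi * cheb_int m f"

text \<open>
  A summable series converges uniformly to a function with the same coefficients as \<open>f\<close>, and
  continuous functions are determined by their coefficients.
\<close>

lemma cheb_series:
  assumes f: "continuous_on {-1..1} f" and s: "summable (\<lambda>m. \<bar>cheb_coeff f m\<bar>)"
  shows "uniform_limit {-1..1} (\<lambda>N x. \<Sum>m<N. cheb_coeff f m * cheb_poly m x) f sequentially"
proof -
  define S where "S x = (\<Sum>m. cheb_coeff f m * cheb_poly m x)" for x
  have u: "uniform_limit {-1..1} (\<lambda>N x. \<Sum>m<N. cheb_coeff f m * cheb_poly m x) S sequentially"
    unfolding S_def[abs_def]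
  proof (rule Weierstrass_m_test[OF _ s])
    fix m x show "norm (cheb_coeff f m * cheb_poly m x) \<le> \<bar>cheb_coeff f m\<bar>"
      using mult_left_mono[OF abs_cheb_poly_le[of m x] abs_ge_zero[of "cheb_coeff f m"]] by (simp add: abs_mult)
  qed
  have cont: "continuous_on {-1..1} (\<lambda>x. \<Sum>m<N. cheb_coeff f m * cheb_poly m x)" for N
    by (intro continuous_intros)
  have cS: "continuous_on {-1..1} S"
    by (rule uniform_limit_theorem[OF always_eventually u]) (simp_all add: cont)
  have "cheb_int m S = cheb_int m f" for m
  proof -
    have uc: "uniform_limit {0..pi} (\<lambda>N t. (\<Sum>i<N. cheb_coeff f i * cheb_poly i (cos t)) * cos (real m * t)) (\<lambda>t. S (cos t) * cos (real m * t)) sequentially"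
    proof (rule uniform_limitI)
      fix e :: real assume e: "e > 0"
      have "\<forall>\<^sub>F N in sequentially. \<forall>x\<in>{-1..1}. dist (\<Sum>i<N. cheb_coeff f i * cheb_poly i x) (S x) < e"
        using u e by (rule uniform_limitD)
      thus "\<forall>\<^sub>F N in sequentially. \<forall>t\<in>{0..pi}. dist ((\<Sum>i<N. cheb_coeff f i * cheb_poly i (cos t)) * cos (real m * t)) (S (cos t) * cos (real m * t)) < e"
      proof eventually_elim
        case (elim N)
        show ?case
        proof
          fix t :: real
          have "dist ((\<Sum>i<N. cheb_coeff f i * cheb_poly i (cos t)) * cos (real m * t)) (S (cos t) * cos (real m * t))
             = dist (\<Sum>i<N. cheb_coeff f i * cheb_poly i (cos t)) (S (cos t)) * \<bar>cos (real m * t)\<bar>"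
            by (simp add: dist_real_def abs_mult[symmetric] left_diff_distrib)
          also have "\<dots> \<le> dist (\<Sum>i<N. cheb_coeff f i * cheb_poly i (cos t)) (S (cos t)) * 1"
            by (intro mult_left_mono) auto
          also have "\<dots> < e" using elim by auto
          finally show "dist ((\<Sum>i<N. cheb_coeff f i * cheb_poly i (cos t)) * cos (real m * t)) (S (cos t) * cos (real m * t)) < e" .
        qed
      qed
    qed
    obtain I J where IJ: "\<And>N. ((\<lambda>t. (\<Sum>i<N. cheb_coeff f i * cheb_poly i (cos t)) * cos (real m * t)) has_integral I N) {0..pi}"
      "((\<lambda>t. S (cos t) * cos (real m * t)) has_integral J) {0..pi}" "I \<longlonglongrightarrow> J"
    proof (rule uniform_limit_integral[OF uc])
      show "continuous_on {0..pi} (\<lambda>t. (\<Sum>i<N. cheb_coeff f i * cheb_poly i (cos t)) * cos (real m * t))" for N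
        by (intro continuous_intros continuous_on_comp_cos[OF cont])
    qed auto
    have I: "I N = cheb_int m f" if "N > m" for N
    proof -
      have "((\<lambda>t. \<Sum>i<N. cheb_coeff f i * (cos (real i * t) * cos (real m * t))) has_integral (\<Sum>i<N. cheb_coeff f i * (if i = m then if m = 0 then pi else pi / 2 else 0))) {0..pi}"
        by (intro has_integral_sum has_integral_mult_right integral_cos_cos) auto
      also have "(\<Sum>i<N. cheb_coeff f i * (if i = m then if m = 0 then pi else pi / 2 else 0)) = (\<Sum>i<N. if i = m then cheb_int m f else 0)"
        by (intro sum.cong) (auto simp: cheb_coeff_def)
      also have "\<dots> = cheb_int m f" using that by simp
      finally have "((\<lambda>t. (\<Sum>i<N. cheb_coeff f i * cheb_poly i (cos t)) * cos (real m * t)) has_integral cheb_int m f) {0..pi}"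
        by (rule has_integral_eq[rotated]) (simp add: cheb_poly_cos sum_distrib_left sum_distrib_right mult_ac)
      thus ?thesis using has_integral_unique[OF IJ(1)] by blast
    qed
    have "I \<longlonglongrightarrow> cheb_int m f"
      by (rule tendsto_eventually) (use I in \<open>auto simp: eventually_at_top_dense intro!: exI[of _ m]\<close>)
    hence "J = cheb_int m f" using IJ(3) LIMSEQ_unique by blast
    thus ?thesis using IJ(2) by (simp add: cheb_int_def integral_unique)
  qed
  note eq = this
  have Sf: "S x = f x" if "x \<in> {-1..1}" for x
  proof -
    have "cheb_int m (\<lambda>x. S x - f x) = 0" for m
    proof -
      have "integral {0..pi} (\<lambda>t. S (cos t) * cos (real m * t) - f (cos t) * cos (real m * t)) = cheb_int m S - cheb_int m f"
        unfolding cheb_int_def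
        by (intro integral_diff integrable_continuous_real continuous_intros continuous_on_comp_cos cS f)
      thus ?thesis using eq[of m] by (simp add: cheb_int_def left_diff_distrib)
    qed
    hence "S x - f x = 0" by (intro cheb_int_eq_0_imp_eq_0[of "\<lambda>x. S x - f x"] continuous_intros cS f that)
    thus ?thesis by simp
  qed
  show ?thesis by (rule uniform_limit_cong'[THEN iffD1, OF _ _ u]) (use Sf in auto)
qed

lemma cc_error_sums:
  assumes f: "continuous_on {-1..1} f" and s: "summable (\<lambda>m. \<bar>cheb_coeff f m\<bar>)"
  shows "(\<lambda>m. cheb_coeff f m * cc_error n (cheb_poly m)) sums cc_error n f"
proof -
  note u = cheb_series[OF f s]
  define p where "p N x = (\<Sum>m<N. cheb_coeff f m * cheb_poly m x)" for N x
  have u': "uniform_limit {-1..1} p f sequentially" using u by (simp add: p_def[abs_def])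
  have hp: "(p N has_integral (\<Sum>m<N. cheb_coeff f m * cheb_poly_integral m)) {-1..1}" for N
    unfolding p_def[abs_def] by (intro has_integral_sum has_integral_mult_right has_integral_cheb_poly) auto
  obtain I J where IJ: "\<And>N. (p N has_integral I N) {-1..1}" "(f has_integral J) {-1..1}" "I \<longlonglongrightarrow> J"
  proof (rule uniform_limit_integral[OF u'])
    show "continuous_on {-1..1} (p N)" for N unfolding p_def[abs_def] by (intro continuous_intros)
  qed auto
  have "I = (\<lambda>N. \<Sum>m<N. cheb_coeff f m * cheb_poly_integral m)"
    using has_integral_unique[OF IJ(1) hp] by auto
  hence 1: "(\<lambda>m. cheb_coeff f m * cheb_poly_integral m) sums integral {-1..1} f"
    using IJ(2,3) by (simp add: sums_def integral_unique)
  have node: "(\<lambda>m. cheb_coeff f m * cheb_poly m (cc_node n j)) sums f (cc_node n j)" for j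
  proof -
    have "cc_node n j \<in> {-1..1}" by (simp add: cc_node_def)
    thus ?thesis using tendsto_uniform_limitI[OF u] by (simp add: sums_def)
  qed
  have "(\<lambda>m. \<Sum>j = 0..n. cc_weight n j * (cheb_coeff f m * cheb_poly m (cc_node n j))) sums cc_rule n f"
    unfolding cc_rule_def by (intro sums_sum sums_mult node)
  also have "(\<lambda>m. \<Sum>j = 0..n. cc_weight n j * (cheb_coeff f m * cheb_poly m (cc_node n j))) = (\<lambda>m. cheb_coeff f m * cc_rule n (cheb_poly m))"
    by (simp add: cc_rule_def sum_distrib_left mult_ac)
  finally have 2: "(\<lambda>m. cheb_coeff f m * cc_rule n (cheb_poly m)) sums cc_rule n f" .
  show ?thesis
    using sums_diff[OF 1 2] integral_unique[OF has_integral_cheb_poly]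
    by (simp add: cc_error_def right_diff_distrib)
qed

section \<open>Aliasing and the quadrature error\<close>

text \<open>
  The first differences on the right and on the left of \<open>0\<close>, up to distance \<open>k\<close>, differ by at most
  \<open>(2 k + 1) D\<close>, and the sum of the first \<open>k\<close> odd numbers is \<open>k\<^sup>2\<close>.
\<close>

lemma second_difference_bound:
  fixes x :: "int \<Rightarrow> real"
  assumes "\<And>j. \<bar>j\<bar> < int k \<Longrightarrow> \<bar>x (j + 1) + x (j - 1) - 2 * x j\<bar> \<le> D"
  shows "\<bar>x (int k) + x (- int k) - 2 * x 0\<bar> \<le> (real k)\<^sup>2 * D"
proof -
  have slope: "\<bar>(x (int k + 1) - x (int k)) - (x (- int k) - x (- int k - 1))\<bar> \<le> (2 * real k + 1) * D"
    if "\<And>j. \<bar>j\<bar> \<le> int k \<Longrightarrow> \<bar>x (j + 1) + x (j - 1) - 2 * x j\<bar> \<le> D" for k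
    using that
  proof (induction k)
    case 0
    show ?case using 0[of 0] by simp
  next
    case (Suc k)
    have IH: "\<bar>(x (int k + 1) - x (int k)) - (x (- int k) - x (- int k - 1))\<bar> \<le> (2 * real k + 1) * D"
      by (rule Suc.IH) (use Suc.prems in auto)
    have 1: "\<bar>x (int k + 1 + 1) + x (int k) - 2 * x (int k + 1)\<bar> \<le> D"
      using Suc.prems[of "int k + 1"] by simp
    have 2: "\<bar>x (- int k) + x (- int k - 1 - 1) - 2 * x (- int k - 1)\<bar> \<le> D"
      using Suc.prems[of "- int k - 1"] by simp
    have i: "int (Suc k) = int k + 1" "- (int k + 1) = - int k - 1" by auto
    have e: "(2 * real (Suc k) + 1) * D = (2 * real k + 1) * D + 2 * D" by (simp add: algebra_simps)
    show ?case using IH 1 2 unfolding i e by linarith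
  qed
  show ?thesis using assms
  proof (induction k)
    case (Suc k)
    have IH: "\<bar>x (int k) + x (- int k) - 2 * x 0\<bar> \<le> (real k)\<^sup>2 * D"
      by (rule Suc.IH) (use Suc.prems in auto)
    have s: "\<bar>(x (int k + 1) - x (int k)) - (x (- int k) - x (- int k - 1))\<bar> \<le> (2 * real k + 1) * D"
      by (rule slope) (use Suc.prems in auto)
    have i: "int (Suc k) = int k + 1" "- (int k + 1) = - int k - 1" by auto
    have e: "(real (Suc k))\<^sup>2 * D = (real k)\<^sup>2 * D + (2 * real k + 1) * D"
      by (simp add: algebra_simps power2_eq_square)
    show ?case using IH s unfolding i e by linarith
  qed simp
qed

lemma cheb_int_second_difference:
  assumes f: "continuous_on {-1..1} f" and m: "m \<ge> 2"
  shows "cheb_int (m + 2) f + cheb_int (m - 2) f - 2 * cheb_int m f = - 4 * cheb_int m (\<lambda>x. (1 - x\<^sup>2) * f x)"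
proof -
  have cf: "continuous_on {0..pi} (\<lambda>t. f (cos t))" by (rule continuous_on_comp_cos[OF f])
  have I: "((\<lambda>t. f (cos t) * cos (real i * t)) has_integral cheb_int i f) {0..pi}" for i
    unfolding cheb_int_def by (intro integrable_integral integrable_continuous_real continuous_intros cf)
  have "((\<lambda>t. f (cos t) * cos (real (m + 2) * t) + f (cos t) * cos (real (m - 2) * t) - 2 * (f (cos t) * cos (real m * t)))
      has_integral (cheb_int (m + 2) f + cheb_int (m - 2) f - 2 * cheb_int m f)) {0..pi}"
    by (intro has_integral_diff has_integral_add has_integral_mult_right I)
  also have "(\<lambda>t. f (cos t) * cos (real (m + 2) * t) + f (cos t) * cos (real (m - 2) * t) - 2 * (f (cos t) * cos (real m * t)))
     = (\<lambda>t. - 4 * ((1 - (cos t)\<^sup>2) * f (cos t) * cos (real m * t)))"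
  proof
    fix t :: real
    have e: "real (m + 2) * t = real m * t + 2 * t" "real (m - 2) * t = real m * t - 2 * t"
      using m by (simp_all add: of_nat_diff algebra_simps)
    show "f (cos t) * cos (real (m + 2) * t) + f (cos t) * cos (real (m - 2) * t) - 2 * (f (cos t) * cos (real m * t))
      = - 4 * ((1 - (cos t)\<^sup>2) * f (cos t) * cos (real m * t))"
      unfolding e cos_add cos_diff cos_double_cos by (simp add: algebra_simps)
  qed
  finally have 1: "((\<lambda>t. - 4 * ((1 - (cos t)\<^sup>2) * f (cos t) * cos (real m * t)))
      has_integral (cheb_int (m + 2) f + cheb_int (m - 2) f - 2 * cheb_int m f)) {0..pi}" .
  have "((\<lambda>t. - 4 * ((1 - (cos t)\<^sup>2) * f (cos t) * cos (real m * t))) has_integral - 4 * cheb_int m (\<lambda>x. (1 - x\<^sup>2) * f x)) {0..pi}"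
    unfolding cheb_int_def by (intro has_integral_mult_right integrable_integral integrable_continuous_real continuous_intros cf)
  thus ?thesis using 1 has_integral_unique by blast
qed

text \<open>
  The cancellation behind the rate: \<open>2 / (1 - 4 k\<^sup>2) = 1 / (2 k + 1) - 1 / (2 k - 1)\<close> telescopes, and the
  full symmetric sum over all integers \<open>r\<close> is \<open>0\<close>.
\<close>

lemma cheb_poly_integral_partial_sum:
  assumes "n \<ge> 1"
  shows "\<bar>2 * (\<Sum>r<n. cheb_poly_integral r) - cheb_poly_integral 0\<bar> \<le> 4 / real n"
proof -
  have odd: "(\<Sum>r<2 * L + 1. cheb_poly_integral r) = 1 + 1 / (2 * real L + 1)" for L
  proof (induction L)
    case 0
    show ?case by (simp add: cheb_poly_integral_def)
  next
    case (Suc L)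
    have "(\<Sum>r<2 * Suc L + 1. cheb_poly_integral r) = (\<Sum>r<2 * L + 1. cheb_poly_integral r) + cheb_poly_integral (2 * L + 1) + cheb_poly_integral (2 * L + 2)"
      by simp
    also have "\<dots> = 1 + 1 / (2 * real L + 1) + 2 / (1 - (2 * real L + 2)\<^sup>2)"
      unfolding Suc by (simp add: cheb_poly_integral_def)
    also have "1 - (2 * real L + 2)\<^sup>2 = - ((2 * real L + 1) * (2 * real L + 3))" by (simp add: power2_eq_square algebra_simps)
    also have "1 + 1 / (2 * real L + 1) + 2 / - ((2 * real L + 1) * (2 * real L + 3)) = 1 + 1 / (2 * real L + 3)"
    proof -
      have "2 * real L + 1 \<noteq> 0" "2 * real L + 3 \<noteq> 0" by linarith+
      thus ?thesis by (simp add: divide_simps) (simp add: algebra_simps)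
    qed
    finally show ?case by (simp add: algebra_simps)
  qed
  define L where "L = (n - 1) div 2"
  have n: "n = 2 * L + 1 \<or> n = 2 * L + 2" using assms unfolding L_def by presburger
  have S: "(\<Sum>r<n. cheb_poly_integral r) = 1 + 1 / (2 * real L + 1)"
    using n
  proof
    assume "n = 2 * L + 2"
    hence "(\<Sum>r<n. cheb_poly_integral r) = (\<Sum>r<2 * L + 1. cheb_poly_integral r) + cheb_poly_integral (2 * L + 1)" by simp
    thus ?thesis by (simp only: odd) (simp add: cheb_poly_integral_def)
  qed (simp only: odd)
  have "2 * (\<Sum>r<n. cheb_poly_integral r) - cheb_poly_integral 0 = 2 / (2 * real L + 1)"
    unfolding S by (simp add: cheb_poly_integral_def)
  also have "\<bar>2 / (2 * real L + 1)\<bar> \<le> 4 / real n"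
    using n by (auto simp: field_simps)
  finally show ?thesis .
qed

lemma sum_block_split:
  fixes g :: "nat \<Rightarrow> real"
  assumes "n \<le> M"
  shows "sum g {M - n..<M + n} = (\<Sum>r<n. g (M + r)) + (\<Sum>r = 1..n. g (M - r))"
proof -
  have "sum g {M - n..<M + n} = sum g {M - n..<M} + sum g {M..<M + n}"
    using assms by (intro sum.atLeastLessThan_concat[symmetric]) auto
  moreover have "sum g {M..<M + n} = (\<Sum>r<n. g (M + r))"
    by (rule sum.reindex_bij_witness[of _ "\<lambda>r. M + r" "\<lambda>m. m - M"]) auto
  moreover have "sum g {M - n..<M} = (\<Sum>r = 1..n. g (M - r))"
    by (rule sum.reindex_bij_witness[of _ "\<lambda>r. M - r" "\<lambda>m. M - m"]) (use assms in auto)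
  ultimately show ?thesis by simp
qed

text \<open>
  The contribution of the indices in \<open>[M - n, M + n)\<close> around \<open>M = 2 n p\<close>. In \<open>X\<close> the exact
  integrals are already \<open>O(1/n\<^sup>2)\<close>. In \<open>Y\<close>, the aliased part, \<open>a M\<close> is subtracted from each coefficient: the term with
  \<open>a M\<close> is small by the cancellation above, and of the rest only second differences remain,
  whose growth \<open>(r/2)\<^sup>2\<close> is compensated by the integral of \<open>T\<^sub>r\<close>. The index \<open>M - n\<close> has no partner on the right and
  is estimated separately.
\<close>

lemma alias_block_bound:
  fixes a :: "nat \<Rightarrow> real"
  assumes n: "n \<ge> 1" and p: "p \<ge> 1" and K: "K \<ge> 0"
    and a: "\<And>m. m \<ge> n * p \<Longrightarrow> \<bar>a m\<bar> \<le> K"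
    and d: "\<And>m. m \<ge> n * p + 2 \<Longrightarrow> \<bar>a (m + 2) + a (m - 2) - 2 * a m\<bar> \<le> 4 * K / (real n)\<^sup>2"
  shows "\<bar>\<Sum>m\<in>{2 * n * p - n..<2 * n * p + n}. a m * cc_error n (cheb_poly m)\<bar> \<le> 20 * K / real n"
proof -
  define M where "M = 2 * n * p"
  let ?c = cheb_poly_integral
  have Mn: "n \<le> n * p" "n * p + n \<le> M" "n \<le> M" using n p by (auto simp: M_def)
  have ge: "M - r \<ge> n * p" if "r \<le> n" for r using that Mn by linarith
  have err: "cc_error n (cheb_poly m) = ?c m - cc_rule n (cheb_poly m)" for m
    by (simp add: cc_error_def integral_unique[OF has_integral_cheb_poly])
  have cm: "\<bar>?c m\<bar> \<le> 4 / (real n)\<^sup>2" if "m \<ge> n" for m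
  proof -
    have "\<bar>?c m\<bar> \<le> 4 / (real m)\<^sup>2" using that n by (intro abs_cheb_poly_integral_le) auto
    also have "\<dots> \<le> 4 / (real n)\<^sup>2" using that n by (intro divide_left_mono power_mono mult_pos_pos) auto
    finally show ?thesis .
  qed
  define X where "X = (\<Sum>r<n. a (M + r) * ?c (M + r)) + (\<Sum>r = 1..n. a (M - r) * ?c (M - r))"
  define Y where "Y = (\<Sum>r<n. a (M + r) * ?c r) + (\<Sum>r = 1..n. a (M - r) * ?c r)"
  have "(\<Sum>m\<in>{M - n..<M + n}. a m * cc_error n (cheb_poly m)) =
      (\<Sum>r<n. a (M + r) * (?c (M + r) - ?c r)) + (\<Sum>r = 1..n. a (M - r) * (?c (M - r) - ?c r))"
    unfolding sum_block_split[OF Mn(3)]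
  proof (intro arg_cong2[where f = "(+)"] sum.cong refl)
    fix r assume "r \<in> {..<n}"
    hence "cc_rule n (cheb_poly (M + r)) = ?c r" unfolding M_def by (intro cc_rule_cheb_poly_alias(1) n) auto
    thus "a (M + r) * cc_error n (cheb_poly (M + r)) = a (M + r) * (?c (M + r) - ?c r)" by (simp add: err)
  next
    fix r assume r: "r \<in> {1..n}"
    hence "cc_rule n (cheb_poly (M - r)) = ?c r"
      unfolding M_def by (intro cc_rule_cheb_poly_alias(2) n) (use r order.trans[OF _ Mn(3)[unfolded M_def], of r] in auto)
    thus "a (M - r) * cc_error n (cheb_poly (M - r)) = a (M - r) * (?c (M - r) - ?c r)" by (simp add: err)
  qed
  also have "\<dots> = X - Y" by (simp add: X_def Y_def right_diff_distrib sum_subtractf)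
  finally have XY: "(\<Sum>m\<in>{M - n..<M + n}. a m * cc_error n (cheb_poly m)) = X - Y" .
  have prodb: "\<bar>a m * y\<bar> \<le> K * z" if "m \<ge> n * p" "\<bar>y\<bar> \<le> z" for m y z
    unfolding abs_mult using that a[of m] K by (intro mult_mono) auto
  have "\<bar>X\<bar> \<le> 8 * K / real n"
  proof -
    have "\<bar>X\<bar> \<le> (\<Sum>r<n. \<bar>a (M + r) * ?c (M + r)\<bar>) + (\<Sum>r = 1..n. \<bar>a (M - r) * ?c (M - r)\<bar>)"
      unfolding X_def by (intro order.trans[OF abs_triangle_ineq] add_mono sum_abs)
    also have "\<dots> \<le> (\<Sum>r<n. K * (4 / (real n)\<^sup>2)) + (\<Sum>r = 1..n. K * (4 / (real n)\<^sup>2))"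
    proof (intro add_mono sum_mono prodb cm)
      fix r assume "r \<in> {1..n}"
      hence "r \<le> n" by simp
      from ge[OF this] Mn show "n * p \<le> M - r" "n \<le> M - r" by linarith+
    qed (use Mn in auto)
    also have "\<dots> = 8 * K / real n" using n by (simp add: power2_eq_square)
    finally show ?thesis .
  qed
  moreover have "\<bar>Y\<bar> \<le> 12 * K / real n"
  proof -
    have "(\<Sum>r = 1..n. a (M - r) * ?c r) = (\<Sum>r<n. a (M - r) * ?c r) - a M * ?c 0 + a (M - n) * ?c n"
    proof -
      have "(\<Sum>r\<le>n. a (M - r) * ?c r) = a M * ?c 0 + (\<Sum>r = 1..n. a (M - r) * ?c r)"
        by (simp add: sum.atMost_shift sum.atLeast1_atMost_eq)
      moreover have "(\<Sum>r\<le>n. a (M - r) * ?c r) = (\<Sum>r<n. a (M - r) * ?c r) + a (M - n) * ?c n"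
        by (simp add: lessThan_Suc_atMost[symmetric])
      ultimately show ?thesis by simp
    qed
    hence "Y = (\<Sum>r<n. a (M + r) * ?c r) + (\<Sum>r<n. a (M - r) * ?c r) - a M * ?c 0 + a (M - n) * ?c n"
      by (simp add: Y_def)
    also have "\<dots> = (\<Sum>r<n. (a (M + r) + a (M - r) - 2 * a M) * ?c r) + a M * (2 * (\<Sum>r<n. ?c r) - ?c 0) + a (M - n) * ?c n"
      by (simp add: algebra_simps sum.distrib sum_subtractf sum_distrib_left)
    finally have Y: "Y = (\<Sum>r<n. (a (M + r) + a (M - r) - 2 * a M) * ?c r) + a M * (2 * (\<Sum>r<n. ?c r) - ?c 0) + a (M - n) * ?c n" .
    have t: "\<bar>(a (M + r) + a (M - r) - 2 * a M) * ?c r\<bar> \<le> 4 * K / (real n)\<^sup>2" if r: "r < n" for r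
    proof (cases "even r \<and> r \<noteq> 0")
      case False
      thus ?thesis using K by (auto simp: cheb_poly_integral_def)
    next
      case True
      then obtain k where k: "r = 2 * k" "k \<ge> 1" by (auto elim!: evenE)
      \<comment> \<open>only even offsets matter, so the step of the second differences is \<open>2\<close>\<close>
      define x where "x j = a (nat (int M + 2 * j))" for j
      have "\<bar>x (int k) + x (- int k) - 2 * x 0\<bar> \<le> (real k)\<^sup>2 * (4 * K / (real n)\<^sup>2)"
      proof (rule second_difference_bound)
        fix j assume j: "\<bar>j\<bar> < int k"
        define m where "m = nat (int M + 2 * j)"
        have bd: "\<bar>2 * j\<bar> \<le> int n - 2" using j k r by linarith
        have im: "int m = int M + 2 * j" using bd Mn by (simp add: m_def)
        have m2: "int (n * p + 2) \<le> int m" using im bd Mn by linarith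
        have e: "nat (int M + 2 * (j + 1)) = m + 2" "nat (int M + 2 * (j - 1)) = m - 2"
        proof -
          have "int M + 2 * (j + 1) = int (m + 2)" using im by simp
          thus "nat (int M + 2 * (j + 1)) = m + 2" by (simp only: nat_int)
          have "2 \<le> m" using m2 by linarith
          hence "int (m - 2) = int m - 2" by (simp add: of_nat_diff)
          hence "int M + 2 * (j - 1) = int (m - 2)" using im by simp
          thus "nat (int M + 2 * (j - 1)) = m - 2" by (simp only: nat_int)
        qed
        show "\<bar>x (j + 1) + x (j - 1) - 2 * x j\<bar> \<le> 4 * K / (real n)\<^sup>2"
          unfolding x_def e m_def[symmetric] using m2 by (intro d) (simp only: of_nat_le_iff)
      qed
      moreover have "x (int k) = a (M + r)" "x (- int k) = a (M - r)" "x 0 = a M"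
      proof -
        have "nat (int M + 2 * int k) = M + r" "nat (int M + 2 * (- int k)) = M - r" "nat (int M + 2 * 0) = M"
          using k by linarith+
        thus "x (int k) = a (M + r)" "x (- int k) = a (M - r)" "x 0 = a M" unfolding x_def by simp_all
      qed
      ultimately have 1: "\<bar>a (M + r) + a (M - r) - 2 * a M\<bar> \<le> (real k)\<^sup>2 * (4 * K / (real n)\<^sup>2)" by simp
      have "\<bar>?c r\<bar> \<le> 4 / (real r)\<^sup>2" using k by (intro abs_cheb_poly_integral_le) auto
      also have "\<dots> = 1 / (real k)\<^sup>2" using k by (simp add: power2_eq_square)
      finally have 2: "\<bar>?c r\<bar> \<le> 1 / (real k)\<^sup>2" .
      have "\<bar>(a (M + r) + a (M - r) - 2 * a M) * ?c r\<bar> \<le> ((real k)\<^sup>2 * (4 * K / (real n)\<^sup>2)) * (1 / (real k)\<^sup>2)"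
        unfolding abs_mult using 1 2 K by (intro mult_mono) auto
      also have "\<dots> = 4 * K / (real n)\<^sup>2" using k by simp
      finally show ?thesis .
    qed
    have "\<bar>\<Sum>r<n. (a (M + r) + a (M - r) - 2 * a M) * ?c r\<bar> \<le> (\<Sum>r<n. 4 * K / (real n)\<^sup>2)"
      by (rule order.trans[OF sum_abs]) (intro sum_mono t, simp)
    also have "\<dots> = 4 * K / real n" using n by (simp add: power2_eq_square)
    finally have 1: "\<bar>\<Sum>r<n. (a (M + r) + a (M - r) - 2 * a M) * ?c r\<bar> \<le> 4 * K / real n" .
    have 2: "\<bar>a M * (2 * (\<Sum>r<n. ?c r) - ?c 0)\<bar> \<le> K * (4 / real n)"
      by (intro prodb cheb_poly_integral_partial_sum n) (use Mn in linarith)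
    have "\<bar>a (M - n) * ?c n\<bar> \<le> K * (4 / (real n)\<^sup>2)" by (intro prodb cm ge) auto
    also have "\<dots> \<le> K * (4 / real n)"
      using n K by (intro mult_left_mono divide_left_mono) (auto simp: power2_eq_square)
    finally have 3: "\<bar>a (M - n) * ?c n\<bar> \<le> K * (4 / real n)" .
    have "\<bar>Y\<bar> \<le> 4 * K / real n + K * (4 / real n) + K * (4 / real n)" unfolding Y using 1 2 3 by linarith
    also have "\<dots> = 12 * K / real n" by (simp add: field_simps)
    finally show ?thesis .
  qed
  ultimately have "\<bar>X - Y\<bar> \<le> 8 * K / real n + 12 * K / real n" by linarith
  also have "\<dots> = 20 * K / real n" by (simp add: field_simps)
  finally show ?thesis using XY by (simp add: M_def)
qed

text \<open>
  The indices from \<open>n\<close> on are grouped into blocks of length \<open>2 n\<close>, block \<open>q\<close> being centred at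
  \<open>2 n (q + 1)\<close>. All indices in it are at least \<open>n (q + 1)\<close>, so the block bounds sum to a
  convergent series in \<open>q\<close>.
\<close>

lemma cc_error_bound_of_cheb_int_decay:
  assumes f: "continuous_on {-1..1} f" and \<sigma>: "\<sigma> > 0" and C: "C \<ge> 0"
    and A: "\<And>m. m \<ge> 1 \<Longrightarrow> \<bar>cheb_int m f\<bar> \<le> C * real m powr (- \<sigma> - 1)"
    and B: "\<And>m. m \<ge> 1 \<Longrightarrow> \<bar>cheb_int m (\<lambda>x. (1 - x\<^sup>2) * f x)\<bar> \<le> C * real m powr (- \<sigma> - 3)"
  shows "\<exists>K. \<forall>n\<ge>1. \<bar>cc_error n f\<bar> \<le> K * real n powr (- \<sigma> - 2)"
proof -
  have pi2: "2 / pi \<ge> 0" "2 / pi \<le> 1" using pi_gt3 by (auto simp: field_simps)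
  have a: "\<bar>cheb_coeff f m\<bar> \<le> C * real m powr (- \<sigma> - 1)" if "m \<ge> 1" for m
  proof -
    have "\<bar>cheb_coeff f m\<bar> = 2 / pi * \<bar>cheb_int m f\<bar>" using that pi2 by (simp add: cheb_coeff_def abs_mult)
    also have "\<dots> \<le> 1 * (C * real m powr (- \<sigma> - 1))" using A[OF that] pi2 by (intro mult_mono) auto
    finally show ?thesis by simp
  qed
  have d: "\<bar>cheb_coeff f (m + 2) + cheb_coeff f (m - 2) - 2 * cheb_coeff f m\<bar> \<le> 4 * (C * real m powr (- \<sigma> - 3))"
    if m: "m \<ge> 3" for m
  proof -
    have "cheb_coeff f (m + 2) + cheb_coeff f (m - 2) - 2 * cheb_coeff f m = 2 / pi * (cheb_int (m + 2) f + cheb_int (m - 2) f - 2 * cheb_int m f)"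
      using m by (simp add: cheb_coeff_def algebra_simps add_divide_distrib diff_divide_distrib)
    also have "cheb_int (m + 2) f + cheb_int (m - 2) f - 2 * cheb_int m f = - 4 * cheb_int m (\<lambda>x. (1 - x\<^sup>2) * f x)"
      using m by (intro cheb_int_second_difference f) auto
    also have "\<bar>2 / pi * (- 4 * cheb_int m (\<lambda>x. (1 - x\<^sup>2) * f x))\<bar> = 2 / pi * (4 * \<bar>cheb_int m (\<lambda>x. (1 - x\<^sup>2) * f x)\<bar>)"
      using pi2 by (simp add: abs_mult)
    also have "\<dots> \<le> 1 * (4 * (C * real m powr (- \<sigma> - 3)))"
      using B[of m] m pi2 by (intro mult_mono mult_left_mono) auto
    finally show ?thesis by simp
  qed
  have summ: "summable (\<lambda>m. real m powr (- \<sigma> - 1))" using \<sigma> by (simp add: summable_real_powr_iff)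
  have s: "summable (\<lambda>m. \<bar>cheb_coeff f m\<bar>)"
    by (rule summable_comparison_test'[OF summable_mult[OF summ, of C], of 1]) (use a in auto)
  define Z where "Z = (\<Sum>q. real (Suc q) powr (- \<sigma> - 1))"
  have sZ: "summable (\<lambda>q. real (Suc q) powr (- \<sigma> - 1))" using summ by (subst summable_Suc_iff)
  have "\<bar>cc_error n f\<bar> \<le> 20 * C * Z * real n powr (- \<sigma> - 2)" if n: "n \<ge> 1" for n
  proof -
    define g where "g m = cheb_coeff f m * cc_error n (cheb_poly m)" for m
    have g0: "g m = 0" if "m < n" for m
      using that cc_rule_cheb_poly[OF n, of m] by (simp add: g_def cc_error_def integral_unique[OF has_integral_cheb_poly])
    have "g sums cc_error n f" unfolding g_def[abs_def] by (rule cc_error_sums[OF f s])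
    hence "(\<lambda>i. g (i + n)) sums (cc_error n f - (\<Sum>i<n. g i))" by (rule sums_split_initial_segment)
    hence "(\<lambda>i. g (i + n)) sums cc_error n f" using g0 by simp
    hence "(\<lambda>q. \<Sum>i\<in>{q * (2 * n)..<q * (2 * n) + 2 * n}. g (i + n)) sums cc_error n f"
      by (rule sums_group) (use n in auto)
    moreover have "(\<Sum>i\<in>{q * (2 * n)..<q * (2 * n) + 2 * n}. g (i + n)) = sum g {2 * n * Suc q - n..<2 * n * Suc q + n}" for q
    proof -
      have "(\<Sum>i\<in>{q * (2 * n)..<q * (2 * n) + 2 * n}. g (i + n)) = sum g {q * (2 * n) + n..<q * (2 * n) + 2 * n + n}"
        by (rule sum.shift_bounds_nat_ivl[symmetric])
      moreover have "q * (2 * n) + n = 2 * n * Suc q - n" "q * (2 * n) + 2 * n + n = 2 * n * Suc q + n"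
        by (simp_all add: algebra_simps)
      ultimately show ?thesis by (simp only:)
    qed
    ultimately have blocks: "(\<lambda>q. sum g {2 * n * Suc q - n..<2 * n * Suc q + n}) sums cc_error n f" by simp
    have bb: "norm (sum g {2 * n * Suc q - n..<2 * n * Suc q + n}) \<le> 20 * C * real n powr (- \<sigma> - 2) * real (Suc q) powr (- \<sigma> - 1)" for q
    proof -
      define w where "w = real (n * Suc q)"
      have w: "w \<ge> real n" "w > 0"
      proof -
        have "n \<le> n * Suc q" by simp
        thus "w \<ge> real n" unfolding w_def by (simp only: of_nat_le_iff)
        thus "w > 0" using n by simp
      qed
      have mono: "real m powr r \<le> w powr r" if "m \<ge> n * Suc q" "r \<le> 0" for m r
        using that w by (intro powr_mono2') (auto simp: w_def simp del: of_nat_mult of_nat_Suc mult_Suc_right)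
      have pos: "m \<ge> 1" if "m \<ge> n * Suc q" for m using that n by (auto intro: order.trans[of 1 "n * Suc q"])
      have "\<bar>\<Sum>m\<in>{2 * n * Suc q - n..<2 * n * Suc q + n}. cheb_coeff f m * cc_error n (cheb_poly m)\<bar> \<le> 20 * (C * w powr (- \<sigma> - 1)) / real n"
      proof (rule alias_block_bound[OF n])
        show "1 \<le> Suc q" by simp
        show "0 \<le> C * w powr (- \<sigma> - 1)" using C by simp
        fix m assume m: "m \<ge> n * Suc q"
        have "\<bar>cheb_coeff f m\<bar> \<le> C * real m powr (- \<sigma> - 1)" by (rule a[OF pos[OF m]])
        also have "\<dots> \<le> C * w powr (- \<sigma> - 1)" using C \<sigma> by (intro mult_left_mono mono m) auto
        finally show "\<bar>cheb_coeff f m\<bar> \<le> C * w powr (- \<sigma> - 1)" .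
      next
        fix m assume m2: "m \<ge> n * Suc q + 2"
        hence m: "m \<ge> n * Suc q" by simp
        have m3: "m \<ge> 3" using m2 pos[of "n * Suc q"] by linarith
        have w3: "w powr (- \<sigma> - 3) \<le> w powr (- \<sigma> - 1) / (real n)\<^sup>2"
        proof -
          have "- \<sigma> - 3 = (- \<sigma> - 1) - 2" by simp
          hence "w powr (- \<sigma> - 3) = w powr (- \<sigma> - 1) / w powr 2" by (simp only: powr_diff)
          also have "\<dots> = w powr (- \<sigma> - 1) / w\<^sup>2" using w by simp
          also have "\<dots> \<le> w powr (- \<sigma> - 1) / (real n)\<^sup>2"
            using w n by (intro divide_left_mono power_mono mult_pos_pos) auto
          finally show ?thesis .
        qed
        show "\<bar>cheb_coeff f (m + 2) + cheb_coeff f (m - 2) - 2 * cheb_coeff f m\<bar> \<le> 4 * (C * w powr (- \<sigma> - 1)) / (real n)\<^sup>2"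
        proof -
          have "\<bar>cheb_coeff f (m + 2) + cheb_coeff f (m - 2) - 2 * cheb_coeff f m\<bar> \<le> 4 * (C * real m powr (- \<sigma> - 3))"
            by (rule d[OF m3])
          also have "\<dots> \<le> 4 * (C * (w powr (- \<sigma> - 1) / (real n)\<^sup>2))"
            using C \<sigma> mono[OF m, of "- \<sigma> - 3"] w3 by (intro mult_left_mono) auto
          finally show ?thesis by simp
        qed
      qed
      also have "w powr (- \<sigma> - 1) = real n powr (- \<sigma> - 1) * real (Suc q) powr (- \<sigma> - 1)"
        unfolding w_def by (simp only: of_nat_mult powr_mult)
      also have "20 * (C * (real n powr (- \<sigma> - 1) * real (Suc q) powr (- \<sigma> - 1))) / real n
          = 20 * C * (real n powr (- \<sigma> - 1) / real n) * real (Suc q) powr (- \<sigma> - 1)" by simp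
      also have "real n powr (- \<sigma> - 1) / real n = real n powr (- \<sigma> - 2)"
      proof -
        have "- \<sigma> - 2 = (- \<sigma> - 1) - 1" by simp
        hence "real n powr (- \<sigma> - 2) = real n powr (- \<sigma> - 1) / real n powr 1" by (simp only: powr_diff)
        thus ?thesis using n by simp
      qed
      finally show ?thesis unfolding g_def[abs_def] real_norm_def .
    qed
    have "norm (\<Sum>q. sum g {2 * n * Suc q - n..<2 * n * Suc q + n}) \<le> (\<Sum>q. 20 * C * real n powr (- \<sigma> - 2) * real (Suc q) powr (- \<sigma> - 1))"
      by (rule norm_suminf_le[OF bb]) (intro summable_mult sZ)
    also have "\<dots> = 20 * C * real n powr (- \<sigma> - 2) * Z" unfolding Z_def by (rule suminf_mult[OF sZ])
    also have "(\<Sum>q. sum g {2 * n * Suc q - n..<2 * n * Suc q + n}) = cc_error n f" using blocks by (rule sums_unique[symmetric])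
    finally show ?thesis by (simp add: mult_ac)
  qed
  thus ?thesis by blast
qed

text \<open>
  The only point that needs an argument is \<open>x = 1\<close>, where the positive power of \<open>1 - x\<close> dominates the logarithm.
\<close>

lemma continuous_on_log_jacobi_fun:
  assumes "\<alpha> > 0" "\<beta> \<ge> 0" "C_inf_on {-1..1} g"
  shows "continuous_on {-1..1} (log_jacobi_fun \<alpha> \<beta> g)"
proof -
  define L where "L x = (1 - x) ^ \<alpha> * ln (1 - x)" for x :: real
  have "jacobi_log \<alpha> (real \<alpha>) 0 L"
    by (rule jacobi_logI[OF C_inf_on_const[of _ 1] C_inf_on_const[of _ 0]]) (simp add: L_def)
  then obtain K where K: "K \<ge> 0" "\<And>x. -1 < x \<Longrightarrow> x < 1 \<Longrightarrow> \<bar>L x\<bar> \<le> K * ((1 - x) powr (1/2) * (1 + x) powr 0)"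
    by (rule jacobi_log_bound[where c' = "1/2" and b' = 0]) (use assms in auto)
  have cL: "continuous_on {-1..1} L"
    unfolding continuous_on_def
  proof
    fix x :: real assume x: "x \<in> {-1..1}"
    show "(L \<longlongrightarrow> L x) (at x within {-1..1})"
    proof (cases "x = 1")
      case False
      hence "isCont L x" unfolding L_def[abs_def] using x by (intro continuous_intros) auto
      thus ?thesis unfolding isCont_def by (rule tendsto_within_subset) simp
    next
      case True
      have "(L \<longlongrightarrow> 0) (at 1 within {-1..1})"
      proof (rule Lim_null_comparison)
        have "\<forall>\<^sub>F y in at 1 within {-1..1}. y > (-1::real)"
          by (rule order_tendstoD(1)[OF tendsto_ident_at]) simp
        moreover have "\<forall>\<^sub>F y in at (1::real) within {-1..1}. y \<in> {-1..1} \<and> y \<noteq> 1"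
          by (simp add: eventually_at_filter)
        ultimately show "\<forall>\<^sub>F y in at 1 within {-1..1}. norm (L y) \<le> K * sqrt (1 - y)"
        proof eventually_elim
          case (elim y)
          hence "-1 < y" "y < 1" by auto
          from K(2)[OF this] this show ?case by (simp add: powr_half_sqrt)
        qed
        have "((\<lambda>y. K * sqrt (1 - y)) \<longlongrightarrow> K * sqrt (1 - 1)) (at 1 within {-1..1})"
          by (intro tendsto_intros)
        thus "((\<lambda>y. K * sqrt (1 - y)) \<longlongrightarrow> 0) (at 1 within {-1..1})" by simp
      qed
      thus ?thesis using True assms(1) by (simp add: L_def)
    qed
  qed
  have cw: "continuous_on {-1..1} (\<lambda>x. if \<beta> = 0 then 1 else (1 + x) powr \<beta>)"
    using assms(2) by (cases "\<beta> = 0") (auto intro!: continuous_intros continuous_on_powr')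
  have "continuous_on {-1..1} (\<lambda>x. L x * (if \<beta> = 0 then 1 else (1 + x) powr \<beta>) * g x)"
    by (intro continuous_on_mult cL cw C_inf_on_continuous assms)
  also have "?this \<longleftrightarrow> continuous_on {-1..1} (log_jacobi_fun \<alpha> \<beta> g)"
    by (rule continuous_on_cong) (use assms(1) in \<open>auto simp: log_jacobi_fun_def L_def\<close>)
  finally show ?thesis .
qed

text \<open>
  The rate \<open>s\<close> is the one for which the coefficients of \<open>f\<close> and of \<open>(1 - x\<^sup>2) f\<close> decay like
  \<open>m\<^bsup>-s-1\<^esup>\<close> and \<open>m\<^bsup>-s-3\<^esup>\<close>. For integer \<open>\<beta>\<close> only the end \<open>1\<close> is singular, and the factor \<open>1 + x\<close> is counted as smooth.
\<close>

theorem theorem3p13: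
  fixes \<alpha> :: nat and \<beta> :: real and g :: "real \<Rightarrow> real"
  assumes "\<alpha> > 0" and "\<beta> \<ge> 0" and "C_inf_on {-1..1} g"
  shows "(\<lambda>n. cc_error n (log_jacobi_fun \<alpha> \<beta> g)) \<in> O(\<lambda>n. real n powr (- cc_rate \<alpha> \<beta> - 2))"
proof -
  define f where "f = log_jacobi_fun \<alpha> \<beta> g"
  define s where "s = cc_rate \<alpha> \<beta>"
  have cont: "continuous_on {-1..1} f" unfolding f_def by (rule continuous_on_log_jacobi_fun[OF assms])
  have cont2: "continuous_on {-1..1} (\<lambda>x. (1 - x\<^sup>2) * f x)" by (intro continuous_intros cont)
  have "s > 0 \<and> (\<exists>C. \<forall>m\<ge>1. \<bar>cheb_int m f\<bar> \<le> C * real m powr (- s - 1)) \<and>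
     (\<exists>C. \<forall>m\<ge>1. \<bar>cheb_int m (\<lambda>x. (1 - x\<^sup>2) * f x)\<bar> \<le> C * real m powr (- s - 3))"
  proof (cases "\<beta> \<in> \<int>")
    case True
    then obtain i where i: "\<beta> = of_int i" by (rule Ints_cases)
    \<comment> \<open>an integer \<open>\<beta>\<close> makes \<open>(1 + x) powr \<beta>\<close> a polynomial, so that the function is smooth at \<open>-1\<close>\<close>
    define k where "k = nat i"
    have k: "\<beta> = real k" using i assms(2) by (simp add: k_def)
    have j: "jacobi_log \<alpha> (real \<alpha>) 0 f"
    proof (rule jacobi_logI)
      show "C_inf_on {-1..1} (\<lambda>x. (1 + x) ^ k * g x)" by (intro C_inf_on_intros assms)
      show "C_inf_on {-1..1} (\<lambda>x. 0)" by (rule C_inf_on_const)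
    qed (auto simp: f_def log_jacobi_fun_def k powr_realpow)
    have "jacobi_log (\<alpha> + 1) (real \<alpha> + real 1) (0 + real 0) (\<lambda>x. (1 - x) ^ 1 * (1 + x) ^ 0 * (1 + x) * f x)"
      by (intro jacobi_log_times_smooth j C_inf_on_intros)
    also have "(\<lambda>x. (1 - x) ^ 1 * (1 + x) ^ 0 * (1 + x) * f x) = (\<lambda>x. (1 - x\<^sup>2) * f x)"
      by (simp add: power2_eq_square algebra_simps)
    finally have j2: "jacobi_log (\<alpha> + 1) (real (\<alpha> + 1)) 0 (\<lambda>x. (1 - x\<^sup>2) * f x)" by (simp add: add.commute)
    have s: "s = 2 * real \<alpha>" using True by (simp add: s_def cc_rate_def)
    have e: "- s - 1 = - 2 * real \<alpha> - 1" "- s - 3 = - 2 * real (\<alpha> + 1) - 1" by (simp_all add: s)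
    show ?thesis unfolding e
      using cheb_int_decay_smooth_left[OF j cheb_integrableI[OF cont]]
        cheb_int_decay_smooth_left[OF j2 cheb_integrableI[OF cont2]] assms(1) s by simp
  next
    case False
    hence b: "\<beta> > 0" using assms(2) by (cases "\<beta> = 0") auto
    have b1: "\<beta> + 1 \<notin> \<int>" using False by (metis Ints_1 Ints_diff add_diff_cancel_right')
    have j: "jacobi_log \<alpha> (real \<alpha>) \<beta> f"
    proof (rule jacobi_logI)
      show "C_inf_on {-1..1} g" "C_inf_on {-1..1} (\<lambda>x. 0)" by (rule assms C_inf_on_const)+
    qed (use b in \<open>auto simp: f_def log_jacobi_fun_def\<close>)
    have "jacobi_log (\<alpha> + 1) (real \<alpha> + real 1) (\<beta> + real 1) (\<lambda>x. (1 - x) ^ 1 * (1 + x) ^ 1 * 1 * f x)"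
      by (intro jacobi_log_times_smooth j C_inf_on_intros)
    also have "(\<lambda>x. (1 - x) ^ 1 * (1 + x) ^ 1 * 1 * f x) = (\<lambda>x. (1 - x\<^sup>2) * f x)"
      by (simp add: power2_eq_square algebra_simps)
    finally have j2: "jacobi_log (\<alpha> + 1) (real (\<alpha> + 1)) (\<beta> + 1) (\<lambda>x. (1 - x\<^sup>2) * f x)" by (simp add: add.commute)
    have s: "s = 2 * min (real \<alpha>) \<beta>" using False by (simp add: s_def cc_rate_def)
    have e: "- s - 1 = - 2 * min (real \<alpha>) \<beta> - 1" "- s - 3 = - 2 * min (real (\<alpha> + 1)) (\<beta> + 1) - 1"
      by (simp_all add: s min_def)
    show ?thesis unfolding e
      using cheb_int_decay_both_ends[OF j cont b False]
        cheb_int_decay_both_ends[OF j2 cont2 _ b1] b assms(1) s by simp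
  qed
  then obtain C1 C2 where s: "s > 0"
    and C1: "\<And>m. m \<ge> 1 \<Longrightarrow> \<bar>cheb_int m f\<bar> \<le> C1 * real m powr (- s - 1)"
    and C2: "\<And>m. m \<ge> 1 \<Longrightarrow> \<bar>cheb_int m (\<lambda>x. (1 - x\<^sup>2) * f x)\<bar> \<le> C2 * real m powr (- s - 3)" by blast
  define C where "C = max 0 (max C1 C2)"
  have C: "C \<ge> 0" "C1 \<le> C" "C2 \<le> C" by (auto simp: C_def)
  have "\<exists>K. \<forall>n\<ge>1. \<bar>cc_error n f\<bar> \<le> K * real n powr (- s - 2)"
  proof (rule cc_error_bound_of_cheb_int_decay[OF cont s C(1)])
    fix m :: nat assume m: "m \<ge> 1"
    show "\<bar>cheb_int m f\<bar> \<le> C * real m powr (- s - 1)"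
      using C1[OF m] mult_right_mono[OF C(2), of "real m powr (- s - 1)"] by simp
    show "\<bar>cheb_int m (\<lambda>x. (1 - x\<^sup>2) * f x)\<bar> \<le> C * real m powr (- s - 3)"
      using C2[OF m] mult_right_mono[OF C(3), of "real m powr (- s - 3)"] by simp
  qed
  then obtain K where K: "\<And>n. n \<ge> 1 \<Longrightarrow> \<bar>cc_error n f\<bar> \<le> K * real n powr (- s - 2)" by blast
  show ?thesis
    unfolding f_def[symmetric] s_def[symmetric]
  proof (rule bigoI[where c = K])
    show "\<forall>\<^sub>F n in at_top. norm (cc_error n f) \<le> K * norm (real n powr (- s - 2))"
      using eventually_ge_at_top[of 1] by eventually_elim (use K in auto)
  qed
qed

end
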